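(* Let $\mathcal{R}\in\{S,LF,KDB,SU,KS\}$, let $(t_k)$ be a sequence of positive reals decreasing to $0$, and let $(x^k)$ be a sequence with $x^k\to\bar x$ such that, for every $k$, $x^k$ is a stationary point of the relaxed problem $\min_{x\in X}\psi^{t_k}_{\mathcal{R}}(x)$. Suppose that $$\lim_{k\to\infty} e\big(\mathcal{S}^{t_k}_{\mathcal{R}}(x^k),\,\mathcal{S}_p(\bar x)\big)=0,$$ that $\bar x$ is upper-level regular, and that $\mathcal{S}_p(\bar x)$ is nonempty and compact. (i) If $\mathcal{R}\in\{S,LF,SU\}$ and the conditions $(A_1^m)$ and $(A_2^m)$ hold at all $(\bar x,y,u)\in\mathrm{gph}\,\mathcal{S}_p$, then $\bar x$ is a C-stationary point. (ii) If $\mathcal{R}\in\{KDB,KS\}$ and the conditions $(A_1^c)$ and $(A_2^c)$ hold at all $(\bar x,y,u)\in\mathrm{gph}\,\mathcal{S}_p$, then $\bar x$ is an M-stationary point.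
   Context: Problem data. $F,f:\mathbb{R}^n\times\mathbb{R}^m\to\mathbb{R}$, $G:\mathbb{R}^n\to\mathbb{R}^p$, $g:\mathbb{R}^n\times\mathbb{R}^m\to\mathbb{R}^q$; $F,G$ are twice and $f,g$ thrice continuously differentiable. $X=\{x\in\mathbb{R}^n: G(x)\le 0\}$. For every $x\in X$: the lower-level problem $\min_y\{f(x,y): g(x,y)\le 0\}$ has at least one solution; $f(x,\cdot)$ and all $g_i(x,\cdot)$ are convex; there is $y(x)\in\mathbb{R}^m$ with $g_i(x,y(x))<0$ for all $i=1,\dots,q$. Put $\mathcal{L}(x,y,u)=\nabla_y f(x,y)+\sum_{i=1}^q u_i\nabla_y g_i(x,y)\in\mathbb{R}^m$, with components $\mathcal{L}_l$; $\nabla_x\mathcal{L}$, $\nabla_y\mathcal{L}$, $\nabla_{x,y}\mathcal{L}$ are the Jacobians with respect to $x$, $y$, $(x,y)$; similarly for $g$, with $\nabla g=\nabla_{x,y}g$. Put $$\mathcal{D}(x)=\{(y,u)\in\mathbb{R}^{m+q}: \mathcal{L}(x,y,u)=0,\ u\ge 0,\ g(x,y)\le 0,\ u^\top g(x,y)=0\}.$$ Relaxations. For $t>0$ and $\mathcal{R}\in\{S,LF,KDB,SU,KS\}$ (Scholtes; Lin–Fukushima; Kadrani–Dussault–Benchakroun; Steffensen–Ulbrich; Kanzow–Schwartz), let $$\mathcal{D}^t_{\mathcal{R}}(x)=\{(y,u)\in\mathbb{R}^{m+q}:\mathcal{L}(x,y,u)=0,\ \phi^t_{i,\mathcal{R}}(x,y,u)\le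 0,\ i=1,\dots,q\},$$ where the vector-valued functions $\phi^t_{i,\mathcal{R}}$ are (writing $g_i=g_i(x,y)$) - $\phi^t_{i,S}=(g_i,\,-u_i,\,-u_ig_i-t)$; - $\phi^t_{i,LF}=(-(u_ig_i+t^2),\,-(u_i+t)(-g_i+t)+t^2)$; - $\phi^t_{i,KDB}=(g_i-t,\,-u_i-t,\,-(u_i-t)(g_i+t))$; - $\phi^t_{i,SU}=(g_i,\,-u_i,\,\varphi^t_{i,SU})$; - $\phi^t_{i,KS}=(g_i,\,-u_i,\,\varphi^t_{i,KS})$. Here $\varphi^t_{i,SU}=2u_i$ if $g_i+u_i\le -t$; $\varphi^t_{i,SU}=-2g_i$ if $g_i+u_i\ge t$; $\varphi^t_{i,SU}=u_i-g_i-t\,\vartheta\big(\frac{u_i+g_i}{t}\big)$ if $|u_i+g_i|<t$, where $\vartheta:[-1,1]\to\mathbb{R}$ is a fixed regularization function: $\vartheta$ is $C^2$ on $[-1,1]$, $\vartheta(\pm1)=1$, $\vartheta'(-1)=-1$, $\vartheta'(1)=1$, $\vartheta''(\pm1)=0$, $\vartheta''>0$ on $(-1,1)$. And $\varphi^t_{i,KS}=(u_i-t)(-g_i-t)$ if $u_i-g_i\ge 2t$; $\varphi^t_{i,KS}=-\frac12\big((u_i-t)^2+(-g_i-t)^2\big)$ if $u_i-g_i<2t$. It is assumed throughout that $\mathcal{D}^t_{\mathcal{R}}(x)\neq\emptyset$ for all $t>0$, $x\in\mathbb{R}^n$ and all $\mathcal{R}$. Value functions and solution maps: $\psi_p(x)=\max_{(y,u)\in\mathcal{D}(x)}F(x,y)$,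 $\psi^t_{\mathcal{R}}(x)=\max_{(y,u)\in\mathcal{D}^t_{\mathcal{R}}(x)}F(x,y)$ (optimal values), $\mathcal{S}_p(x)=\{(y,u)\in\mathcal{D}(x):F(x,y)\ge\psi_p(x)\}$, $\mathcal{S}^t_{\mathcal{R}}(x)=\{(y,u)\in\mathcal{D}^t_{\mathcal{R}}(x):F(x,y)\ge\psi^t_{\mathcal{R}}(x)\}$. $\mathrm{gph}$ denotes the graph: $(x,y,u)\in\mathrm{gph}\,\mathcal{S}_p$ iff $(y,u)\in\mathcal{S}_p(x)$. The excess is $e(A,B)=\sup_{a\in A}\inf_{b\in B}\|a-b\|$, with $e(\emptyset,B)=0$ and $e(A,\emptyset)=+\infty$ if $A\ne\emptyset$. Stationary point of the relaxed problem. For $t>0$, $x^t$ is a stationary point of $\min_{x\in X}\psi^t_{\mathcal{R}}(x)$ if there are $(y^t,u^t)$, $\alpha\in\mathbb{R}^p$, $\beta\in\mathbb{R}^m$ and multiplier vectors $\lambda_i$ ($i=1,\dots,q$; $\lambda_i$ has as many components as $\phi^t_{i,\mathcal{R}}$, and $\lambda_i\nabla\phi^t_{i,\mathcal{R}}$ denotes the sum over components) such that $(x^t,y^t,u^t)\in\mathrm{gph}\,\mathcal{S}^t_{\mathcal{R}}$ and, with all functions evaluated at $(x^t,y^t,u^t)$, $$\nabla_xF+\nabla G(x^t)^\top\alpha-\nabla_x\mathcal{L}^\top\beta-\sum_{i=1}^q\lambda_i\nabla_x\phi^t_{i,\mathcal{R}}=0,\qquad \nabla_yF-\nabla_y\mathcal{L}^\top\beta-\sum_{i=1}^q\lambda_i\nabla_y\phi^t_{i,\mathcal{R}}=0,$$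 $$-\nabla_yg_i\,\beta-\lambda_i\nabla_{u_i}\phi^t_{i,\mathcal{R}}=0\quad(i=1,\dots,q),$$ $\alpha_j\ge 0$, $G_j(x^t)\le 0$, $\alpha_jG_j(x^t)=0$ ($j=1,\dots,p$), and $\lambda_i\ge 0$, $\phi^t_{i,\mathcal{R}}\le 0$, with componentwise complementarity $\lambda_i\phi^t_{i,\mathcal{R}}=0$ ($i=1,\dots,q$). Here $\nabla_yg_i\,\beta=\sum_{l=1}^m\beta_l\,\partial g_i/\partial y_l$. Index sets at $(\bar x,\bar y,\bar u)$ with $(\bar y,\bar u)\in\mathcal{D}(\bar x)$: $\eta=\{i:\bar u_i=0,\ g_i(\bar x,\bar y)<0\}$, $\theta=\{i:\bar u_i=0,\ g_i(\bar x,\bar y)=0\}$, $\nu=\{i:\bar u_i>0,\ g_i(\bar x,\bar y)=0\}$. C-stationarity. $\bar x$ is a C-stationary point (of the pessimistic bilevel problem $\min_{x\in X}\max\{F(x,y): y\in \arg\min_z\{f(x,z):g(x,z)\le0\}\}$) if there is $(\bar y,\bar u,\alpha,\beta,\gamma)\in\mathbb{R}^m\times\mathbb{R}^q\times\mathbb{R}^p\times\mathbb{R}^m\times\mathbb{R}^q$ with $(\bar x,\bar y,\bar u)\in\mathrm{gph}\,\mathcal{S}_p$ and $$\nabla_xF(\bar x,\bar y)+\sum_{j=1}^p\alpha_j\nabla G_j(\bar x)+\sum_{l=1}^m\beta_l\nabla_x\mathcal{L}_l(\bar x,\bar y,\bar u)+\sum_{i=1}^q\gamma_i\nabla_xg_i(\bar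 x,\bar y)=0,$$ $$\nabla_yF(\bar x,\bar y)+\sum_{l=1}^m\beta_l\nabla_y\mathcal{L}_l(\bar x,\bar y,\bar u)+\sum_{i=1}^q\gamma_i\nabla_yg_i(\bar x,\bar y)=0,$$ $\alpha\ge0$, $G(\bar x)\le0$, $\alpha^\top G(\bar x)=0$; $\nabla_yg_i(\bar x,\bar y)\beta=0$ for $i\in\nu$; $\gamma_i=0$ for $i\in\eta$; and $\gamma_i\,\nabla_yg_i(\bar x,\bar y)\beta\ge0$ for all $i\in\theta$. M-stationarity: the same, with the last condition replaced by: for all $i\in\theta$, either ($\gamma_i<0$ and $\nabla_yg_i(\bar x,\bar y)\beta<0$) or $\gamma_i\,\nabla_yg_i(\bar x,\bar y)\beta=0$. Upper-level regularity at $\bar x$: $\nabla G(\bar x)^\top\alpha=0$, $\alpha\ge0$, $\alpha^\top G(\bar x)=0$ imply $\alpha=0$. Qualification conditions at $(\bar x,\bar y,\bar u)$. $\Lambda^{ec}$ is the set of $(\beta,\gamma)\in\mathbb{R}^{m+q}$ with $\nabla_yg_i(\bar x,\bar y)\beta=0$ for $i\in\nu$, $\gamma_i=0$ for $i\in\eta$, $\gamma_i\nabla_yg_i(\bar x,\bar y)\beta\ge0$ for $i\in\theta$, and $\nabla_{x,y}\mathcal{L}(\bar x,\bar y,\bar u)^\top\beta+\nabla g(\bar x,\bar y)^\top\gamma=0$. $\Lambda^{ec}_y$ is defined identically except that the last equation is replaced by $\nabla_y\mathcal{L}(\bar x,\bar y,\bar u)^\top\beta+\nabla_yg(\bar x,\bar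 y)^\top\gamma=0$. The sets $\Lambda^{em}$, $\Lambda^{em}_y$ are defined as $\Lambda^{ec}$, $\Lambda^{ec}_y$ with the condition on $\theta$ replaced by: for all $i\in\theta$, either ($\gamma_i<0$ and $\nabla_yg_i(\bar x,\bar y)\beta<0$) or $\gamma_i\nabla_yg_i(\bar x,\bar y)\beta=0$. For $*\in\{c,m\}$: - $(A_1^* )$: $(\beta,\gamma)\in\Lambda^{e*}$ implies $\beta=0$, $\gamma=0$; - $(A_2^* )$: $(\beta,\gamma)\in\Lambda^{e*}_y$ implies $\nabla_x\mathcal{L}(\bar x,\bar y,\bar u)^\top\beta+\nabla_xg(\bar x,\bar y)^\top\gamma=0$. *)

theory Defs
  imports "HOL-Analysis.Analysis"
begin

section \<open>Calculus\<close>

text \<open>All partial gradients are obtained by applying \<^const>\<open>gderiv\<close> to the section of a function in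
  which the other variables are frozen.\<close>

definition nabla :: "('a::real_inner \<Rightarrow> real) \<Rightarrow> 'a \<Rightarrow> 'a" where
  "nabla h z = (THE d. GDERIV h z :> d)"

text \<open>\<open>jacT h z w\<close> is the transposed Jacobian of \<open>h\<close> at \<open>z\<close> applied to \<open>w\<close>,
  i.e. the combination of the gradients of the components of \<open>h\<close> with coefficients \<open>w\<close>.\<close>

definition jacT :: "('a::real_inner \<Rightarrow> real ^ 'k) \<Rightarrow> 'a \<Rightarrow> real ^ 'k \<Rightarrow> 'a" where
  "jacT h z w = (\<Sum>l\<in>UNIV. w $ l *\<^sub>R nabla (\<lambda>z'. h z' $ l) z)"

text \<open>Continuous differentiability of order \<open>k\<close> on the whole (finite-dimensional) space, by
  recursion on directional derivatives.\<close>

primrec cont_diff :: "nat \<Rightarrow> ('a::euclidean_space \<Rightarrow> 'b::real_normed_vector) \<Rightarrow> bool" where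
  "cont_diff 0 h \<longleftrightarrow> continuous_on UNIV h"
| "cont_diff (Suc k) h \<longleftrightarrow>
     (\<forall>z. h differentiable (at z)) \<and> (\<forall>v. cont_diff k (\<lambda>z. frechet_derivative h (at z) v))"

section \<open>Set-valued maps\<close>

definition gph :: "('a \<Rightarrow> 'b set) \<Rightarrow> ('a \<times> 'b) set" where
  "gph S = {(x, w). w \<in> S x}"

text \<open>In \<^typ>\<open>ennreal\<close> the supremum of the empty set is \<open>0\<close> and its infimum is \<open>\<infinity>\<close>; hence
  \<open>excess {} B = 0\<close> and \<open>excess A {} = \<infinity>\<close> for nonempty \<open>A\<close>.\<close>

definition excess :: "'a::real_normed_vector set \<Rightarrow> 'a set \<Rightarrow> ennreal" where
  "excess A B = (SUP a\<in>A. INF b\<in>B. ennreal (norm (a - b)))"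

text \<open>Optimal value and solution set of maximizing \<open>F (x, y)\<close> over \<open>(y, u) \<in> D x\<close>. The value is an
  extended real, so that it is \<open>\<infinity>\<close> (and the solution set empty) if \<open>F (x, \<cdot>)\<close> is unbounded above.\<close>

definition max_value ::
    "('x \<times> 'y \<Rightarrow> real) \<Rightarrow> ('x \<Rightarrow> ('y \<times> 'u) set) \<Rightarrow> 'x \<Rightarrow> ereal" where
  "max_value F D x = (SUP (y, u)\<in>D x. ereal (F (x, y)))"

definition max_solutions ::
    "('x \<times> 'y \<Rightarrow> real) \<Rightarrow> ('x \<Rightarrow> ('y \<times> 'u) set) \<Rightarrow> 'x \<Rightarrow> ('y \<times> 'u) set" where
  "max_solutions F D x = {(y, u) \<in> D x. ereal (F (x, y)) \<ge> max_value F D x}"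

section \<open>The lower-level problem and its optimality system\<close>

definition lower_solutions ::
    "((real ^ 'n) \<times> (real ^ 'm) \<Rightarrow> real) \<Rightarrow> ((real ^ 'n) \<times> (real ^ 'm) \<Rightarrow> real ^ 'q) \<Rightarrow>
     real ^ 'n \<Rightarrow> (real ^ 'm) set" where
  "lower_solutions f g x = {y. g (x, y) \<le> 0 \<and> (\<forall>z. g (x, z) \<le> 0 \<longrightarrow> f (x, y) \<le> f (x, z))}"

definition lagr ::
    "((real ^ 'n) \<times> (real ^ 'm) \<Rightarrow> real) \<Rightarrow> ((real ^ 'n) \<times> (real ^ 'm) \<Rightarrow> real ^ 'q) \<Rightarrow>
     (real ^ 'n) \<times> (real ^ 'm) \<times> (real ^ 'q) \<Rightarrow> real ^ 'm" where
  "lagr f g = (\<lambda>(x, y, u). nabla (\<lambda>y'. f (x, y')) y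
     + (\<Sum>i\<in>UNIV. u $ i *\<^sub>R nabla (\<lambda>y'. g (x, y') $ i) y))"

definition kkt_set ::
    "((real ^ 'n) \<times> (real ^ 'm) \<Rightarrow> real) \<Rightarrow> ((real ^ 'n) \<times> (real ^ 'm) \<Rightarrow> real ^ 'q) \<Rightarrow>
     real ^ 'n \<Rightarrow> ((real ^ 'm) \<times> (real ^ 'q)) set" where
  "kkt_set f g x =
     {(y, u). lagr f g (x, y, u) = 0 \<and> 0 \<le> u \<and> g (x, y) \<le> 0 \<and> u \<bullet> g (x, y) = 0}"

abbreviation S_p where
  "S_p F f g \<equiv> max_solutions F (kkt_set f g)"

section \<open>Relaxations\<close>

datatype relaxation =
  Scholtes | Lin_Fukushima | Kadrani_Dussault_Benchakroun | Steffensen_Ulbrich | Kanzow_Schwartz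

text \<open>The regularization function lives on \<open>[-1, 1]\<close>; its derivatives at the end points are
  one-sided, and its values outside are never used.\<close>

definition regularization_function :: "(real \<Rightarrow> real) \<Rightarrow> bool" where
  "regularization_function \<theta> \<longleftrightarrow> (\<exists>\<theta>' \<theta>''.
     (\<forall>s\<in>{-1..1}. (\<theta> has_real_derivative \<theta>' s) (at s within {-1..1})) \<and>
     (\<forall>s\<in>{-1..1}. (\<theta>' has_real_derivative \<theta>'' s) (at s within {-1..1})) \<and>
     continuous_on {-1..1} \<theta>'' \<and>
     \<theta> (-1) = 1 \<and> \<theta> 1 = 1 \<and> \<theta>' (-1) = -1 \<and> \<theta>' 1 = 1 \<and> \<theta>'' (-1) = 0 \<and> \<theta>'' 1 = 0 \<and>
     (\<forall>s\<in>{-1<..<1}. \<theta>'' s > 0))"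

definition phi_SU :: "(real \<Rightarrow> real) \<Rightarrow> real \<Rightarrow> real \<Rightarrow> real \<Rightarrow> real" where
  "phi_SU \<theta> t gi ui =
     (if gi + ui \<le> - t then 2 * ui
      else if gi + ui \<ge> t then - 2 * gi
      else ui - gi - t * \<theta> ((ui + gi) / t))"

definition phi_KS :: "real \<Rightarrow> real \<Rightarrow> real \<Rightarrow> real" where
  "phi_KS t gi ui =
     (if ui - gi \<ge> 2 * t then (ui - t) * (- gi - t)
      else - (1 / 2) * ((ui - t)\<^sup>2 + (- gi - t)\<^sup>2))"

text \<open>The components of the vector-valued relaxation function as functions of the pair
  \<open>g\<^sub>i(x, y)\<close>, \<open>u\<^sub>i\<close>. Their number depends on the relaxation, hence the list.\<close>

fun phi_list :: "relaxation \<Rightarrow> (real \<Rightarrow> real) \<Rightarrow> real \<Rightarrow> (real \<Rightarrow> real \<Rightarrow> real) list" where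
  "phi_list Scholtes \<theta> t =
     [\<lambda>gi ui. gi, \<lambda>gi ui. - ui, \<lambda>gi ui. - ui * gi - t]"
| "phi_list Lin_Fukushima \<theta> t =
     [\<lambda>gi ui. - (ui * gi + t\<^sup>2), \<lambda>gi ui. - (ui + t) * (- gi + t) + t\<^sup>2]"
| "phi_list Kadrani_Dussault_Benchakroun \<theta> t =
     [\<lambda>gi ui. gi - t, \<lambda>gi ui. - ui - t, \<lambda>gi ui. - (ui - t) * (gi + t)]"
| "phi_list Steffensen_Ulbrich \<theta> t =
     [\<lambda>gi ui. gi, \<lambda>gi ui. - ui, phi_SU \<theta> t]"
| "phi_list Kanzow_Schwartz \<theta> t =
     [\<lambda>gi ui. gi, \<lambda>gi ui. - ui, phi_KS t]"

definition phi ::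
    "relaxation \<Rightarrow> (real \<Rightarrow> real) \<Rightarrow> ((real ^ 'n) \<times> (real ^ 'm) \<Rightarrow> real ^ 'q) \<Rightarrow> real \<Rightarrow> 'q \<Rightarrow> nat \<Rightarrow>
     (real ^ 'n) \<times> (real ^ 'm) \<times> (real ^ 'q) \<Rightarrow> real" where
  "phi R \<theta> g t i j = (\<lambda>(x, y, u). (phi_list R \<theta> t ! j) (g (x, y) $ i) (u $ i))"

abbreviation phi_idx :: "relaxation \<Rightarrow> (real \<Rightarrow> real) \<Rightarrow> real \<Rightarrow> nat set" where
  "phi_idx R \<theta> t \<equiv> {..<length (phi_list R \<theta> t)}"

definition relaxed_set ::
    "relaxation \<Rightarrow> (real \<Rightarrow> real) \<Rightarrow> ((real ^ 'n) \<times> (real ^ 'm) \<Rightarrow> real) \<Rightarrow>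
     ((real ^ 'n) \<times> (real ^ 'm) \<Rightarrow> real ^ 'q) \<Rightarrow> real \<Rightarrow>
     real ^ 'n \<Rightarrow> ((real ^ 'm) \<times> (real ^ 'q)) set" where
  "relaxed_set R \<theta> f g t x =
     {(y, u). lagr f g (x, y, u) = 0 \<and> (\<forall>i. \<forall>j\<in>phi_idx R \<theta> t. phi R \<theta> g t i j (x, y, u) \<le> 0)}"

abbreviation S_relaxed where
  "S_relaxed R \<theta> F f g t \<equiv> max_solutions F (relaxed_set R \<theta> f g t)"

definition relaxed_stationary ::
    "relaxation \<Rightarrow> (real \<Rightarrow> real) \<Rightarrow> ((real ^ 'n) \<times> (real ^ 'm) \<Rightarrow> real) \<Rightarrow>
     (real ^ 'n \<Rightarrow> real ^ 'p) \<Rightarrow> ((real ^ 'n) \<times> (real ^ 'm) \<Rightarrow> real) \<Rightarrow>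
     ((real ^ 'n) \<times> (real ^ 'm) \<Rightarrow> real ^ 'q) \<Rightarrow> real \<Rightarrow> real ^ 'n \<Rightarrow> bool" where
  "relaxed_stationary R \<theta> F G f g t x \<longleftrightarrow>
     (\<exists>y u \<alpha> \<beta> (mult :: 'q \<Rightarrow> nat \<Rightarrow> real).
        (x, y, u) \<in> gph (S_relaxed R \<theta> F f g t) \<and>
        nabla (\<lambda>x'. F (x', y)) x + jacT G x \<alpha> - jacT (\<lambda>x'. lagr f g (x', y, u)) x \<beta>
          - (\<Sum>i\<in>UNIV. \<Sum>j\<in>phi_idx R \<theta> t. mult i j *\<^sub>R nabla (\<lambda>x'. phi R \<theta> g t i j (x', y, u)) x) = 0 \<and>
        nabla (\<lambda>y'. F (x, y')) y - jacT (\<lambda>y'. lagr f g (x, y', u)) y \<beta>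
          - (\<Sum>i\<in>UNIV. \<Sum>j\<in>phi_idx R \<theta> t. mult i j *\<^sub>R nabla (\<lambda>y'. phi R \<theta> g t i j (x, y', u)) y) = 0 \<and>
        (\<forall>i. - (nabla (\<lambda>y'. g (x, y') $ i) y \<bullet> \<beta>)
          - (\<Sum>j\<in>phi_idx R \<theta> t. mult i j * nabla (\<lambda>u'. phi R \<theta> g t i j (x, y, u')) u $ i) = 0) \<and>
        (\<forall>j. \<alpha> $ j \<ge> 0 \<and> G x $ j \<le> 0 \<and> \<alpha> $ j * G x $ j = 0) \<and>
        (\<forall>i. \<forall>j\<in>phi_idx R \<theta> t. mult i j \<ge> 0 \<and> phi R \<theta> g t i j (x, y, u) \<le> 0 \<and>
          mult i j * phi R \<theta> g t i j (x, y, u) = 0))"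

section \<open>C- and M-stationarity, qualification conditions\<close>

definition idx_eta ::
    "((real ^ 'n) \<times> (real ^ 'm) \<Rightarrow> real ^ 'q) \<Rightarrow> (real ^ 'n) \<times> (real ^ 'm) \<times> (real ^ 'q) \<Rightarrow> 'q set" where
  "idx_eta g = (\<lambda>(x, y, u). {i. u $ i = 0 \<and> g (x, y) $ i < 0})"

definition idx_theta ::
    "((real ^ 'n) \<times> (real ^ 'm) \<Rightarrow> real ^ 'q) \<Rightarrow> (real ^ 'n) \<times> (real ^ 'm) \<times> (real ^ 'q) \<Rightarrow> 'q set" where
  "idx_theta g = (\<lambda>(x, y, u). {i. u $ i = 0 \<and> g (x, y) $ i = 0})"

definition idx_nu ::
    "((real ^ 'n) \<times> (real ^ 'm) \<Rightarrow> real ^ 'q) \<Rightarrow> (real ^ 'n) \<times> (real ^ 'm) \<times> (real ^ 'q) \<Rightarrow> 'q set" where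
  "idx_nu g = (\<lambda>(x, y, u). {i. u $ i > 0 \<and> g (x, y) $ i = 0})"

text \<open>The two conditions imposed on biactive indices, relating \<open>\<gamma>\<^sub>i\<close> and \<open>a = \<nabla>\<^sub>y g\<^sub>i \<beta>\<close>.\<close>

definition c_sign :: "real \<Rightarrow> real \<Rightarrow> bool" where
  "c_sign \<gamma> a \<longleftrightarrow> \<gamma> * a \<ge> 0"

definition m_sign :: "real \<Rightarrow> real \<Rightarrow> bool" where
  "m_sign \<gamma> a \<longleftrightarrow> (\<gamma> < 0 \<and> a < 0) \<or> \<gamma> * a = 0"

text \<open>The part common to the stationarity systems and the sets \<open>\<Lambda>\<close>; the parameter \<open>sgc\<close> is
  \<^const>\<open>c_sign\<close> or \<^const>\<open>m_sign\<close>.\<close>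

definition sign_system ::
    "(real \<Rightarrow> real \<Rightarrow> bool) \<Rightarrow> ((real ^ 'n) \<times> (real ^ 'm) \<Rightarrow> real ^ 'q) \<Rightarrow>
     (real ^ 'n) \<times> (real ^ 'm) \<times> (real ^ 'q) \<Rightarrow> real ^ 'm \<Rightarrow> real ^ 'q \<Rightarrow> bool" where
  "sign_system sgc g = (\<lambda>(x, y, u) \<beta> \<gamma>.
     (\<forall>i\<in>idx_nu g (x, y, u). nabla (\<lambda>y'. g (x, y') $ i) y \<bullet> \<beta> = 0) \<and>
     (\<forall>i\<in>idx_eta g (x, y, u). \<gamma> $ i = 0) \<and>
     (\<forall>i\<in>idx_theta g (x, y, u). sgc (\<gamma> $ i) (nabla (\<lambda>y'. g (x, y') $ i) y \<bullet> \<beta>)))"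

definition bilevel_stationary ::
    "(real \<Rightarrow> real \<Rightarrow> bool) \<Rightarrow> ((real ^ 'n) \<times> (real ^ 'm) \<Rightarrow> real) \<Rightarrow>
     (real ^ 'n \<Rightarrow> real ^ 'p) \<Rightarrow> ((real ^ 'n) \<times> (real ^ 'm) \<Rightarrow> real) \<Rightarrow>
     ((real ^ 'n) \<times> (real ^ 'm) \<Rightarrow> real ^ 'q) \<Rightarrow> real ^ 'n \<Rightarrow> bool" where
  "bilevel_stationary sgc F G f g x \<longleftrightarrow>
     (\<exists>y u \<alpha> \<beta> \<gamma>.
        (x, y, u) \<in> gph (S_p F f g) \<and>
        nabla (\<lambda>x'. F (x', y)) x + jacT G x \<alpha> + jacT (\<lambda>x'. lagr f g (x', y, u)) x \<beta>
          + jacT (\<lambda>x'. g (x', y)) x \<gamma> = 0 \<and>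
        nabla (\<lambda>y'. F (x, y')) y + jacT (\<lambda>y'. lagr f g (x, y', u)) y \<beta>
          + jacT (\<lambda>y'. g (x, y')) y \<gamma> = 0 \<and>
        \<alpha> \<ge> 0 \<and> G x \<le> 0 \<and> \<alpha> \<bullet> G x = 0 \<and>
        sign_system sgc g (x, y, u) \<beta> \<gamma>)"

abbreviation C_stationary where "C_stationary \<equiv> bilevel_stationary c_sign"
abbreviation M_stationary where "M_stationary \<equiv> bilevel_stationary m_sign"

definition upper_level_regular :: "(real ^ 'n \<Rightarrow> real ^ 'p) \<Rightarrow> real ^ 'n \<Rightarrow> bool" where
  "upper_level_regular G x \<longleftrightarrow>
     (\<forall>\<alpha>. jacT G x \<alpha> = 0 \<and> \<alpha> \<ge> 0 \<and> \<alpha> \<bullet> G x = 0 \<longrightarrow> \<alpha> = 0)"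

definition Lambda_e ::
    "(real \<Rightarrow> real \<Rightarrow> bool) \<Rightarrow> ((real ^ 'n) \<times> (real ^ 'm) \<Rightarrow> real) \<Rightarrow>
     ((real ^ 'n) \<times> (real ^ 'm) \<Rightarrow> real ^ 'q) \<Rightarrow>
     (real ^ 'n) \<times> (real ^ 'm) \<times> (real ^ 'q) \<Rightarrow> ((real ^ 'm) \<times> (real ^ 'q)) set" where
  "Lambda_e sgc f g = (\<lambda>(x, y, u). {(\<beta>, \<gamma>). sign_system sgc g (x, y, u) \<beta> \<gamma> \<and>
     jacT (\<lambda>(x', y'). lagr f g (x', y', u)) (x, y) \<beta> + jacT g (x, y) \<gamma> = 0})"

definition Lambda_e_y ::
    "(real \<Rightarrow> real \<Rightarrow> bool) \<Rightarrow> ((real ^ 'n) \<times> (real ^ 'm) \<Rightarrow> real) \<Rightarrow>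
     ((real ^ 'n) \<times> (real ^ 'm) \<Rightarrow> real ^ 'q) \<Rightarrow>
     (real ^ 'n) \<times> (real ^ 'm) \<times> (real ^ 'q) \<Rightarrow> ((real ^ 'm) \<times> (real ^ 'q)) set" where
  "Lambda_e_y sgc f g = (\<lambda>(x, y, u). {(\<beta>, \<gamma>). sign_system sgc g (x, y, u) \<beta> \<gamma> \<and>
     jacT (\<lambda>y'. lagr f g (x, y', u)) y \<beta> + jacT (\<lambda>y'. g (x, y')) y \<gamma> = 0})"

definition cond_A1 ::
    "(real \<Rightarrow> real \<Rightarrow> bool) \<Rightarrow> ((real ^ 'n) \<times> (real ^ 'm) \<Rightarrow> real) \<Rightarrow>
     ((real ^ 'n) \<times> (real ^ 'm) \<Rightarrow> real ^ 'q) \<Rightarrow>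
     (real ^ 'n) \<times> (real ^ 'm) \<times> (real ^ 'q) \<Rightarrow> bool" where
  "cond_A1 sgc f g z \<longleftrightarrow> (\<forall>\<beta> \<gamma>. (\<beta>, \<gamma>) \<in> Lambda_e sgc f g z \<longrightarrow> \<beta> = 0 \<and> \<gamma> = 0)"

definition cond_A2 ::
    "(real \<Rightarrow> real \<Rightarrow> bool) \<Rightarrow> ((real ^ 'n) \<times> (real ^ 'm) \<Rightarrow> real) \<Rightarrow>
     ((real ^ 'n) \<times> (real ^ 'm) \<Rightarrow> real ^ 'q) \<Rightarrow>
     (real ^ 'n) \<times> (real ^ 'm) \<times> (real ^ 'q) \<Rightarrow> bool" where
  "cond_A2 sgc f g = (\<lambda>(x, y, u). \<forall>\<beta> \<gamma>. (\<beta>, \<gamma>) \<in> Lambda_e_y sgc f g (x, y, u) \<longrightarrow>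
     jacT (\<lambda>x'. lagr f g (x', y, u)) x \<beta> + jacT (\<lambda>x'. g (x', y)) x \<gamma> = 0)"

end

theory Submission
  imports Defs
begin

text \<open>The multipliers of the relaxed problems are pushed to the limit. Write \<open>\<beta>\<close> for the negated multiplier
of the equation \<open>\<L> = 0\<close>, \<open>a\<^sub>i = \<nabla>\<^sub>y g\<^sub>i \<beta>\<close>, and let \<open>\<gamma>\<^sub>i\<close> be minus the sum of the multipliers of the
\<open>i\<close>-th relaxed constraint weighted with its derivatives with respect to \<open>g\<^sub>i\<close>. The equation in
\<open>u\<^sub>i\<close> says that \<open>a\<^sub>i\<close> is the analogous sum of derivatives with respect to \<open>u\<^sub>i\<close>, and the other two
equations become the equations of C- and M-stationarity in \<open>(\<alpha>, \<beta>, \<gamma>)\<close>, except that they hold at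
the points \<open>(x\<^sup>k, y\<^sup>k, u\<^sup>k)\<close> instead of the limit point.

All that distinguishes the five relaxations is a planar question about one index, answered by
\<open>relaxation_multiplier_signs\<close>: always \<open>\<bar>a\<^sub>i u\<^sub>i + \<gamma>\<^sub>i g\<^sub>i\<bar> \<le> t (\<bar>a\<^sub>i\<bar> + \<bar>\<gamma>\<^sub>i\<bar>)\<close> and \<open>\<gamma>\<^sub>i a\<^sub>i \<ge> 0\<close>, and for
the relaxations of Kadrani-Dussault-Benchakroun and Kanzow-Schwartz the pair \<open>(\<gamma>\<^sub>i, a\<^sub>i)\<close> even lies
in the cone of M-stationarity. These relations are closed and survive multiplication of
\<open>(\<beta>, \<gamma>)\<close> by nonnegative numbers. In the limit \<open>t \<rightarrow> 0\<close> the estimate becomes \<open>a\<^sub>i u\<^sub>i + \<gamma>\<^sub>i g\<^sub>i = 0\<close>, so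
that \<open>a\<^sub>i = 0\<close> for \<open>i \<in> \<nu>\<close> and \<open>\<gamma>\<^sub>i = 0\<close> for \<open>i \<in> \<eta>\<close>.

It remains to bound the multipliers. If \<open>(\<beta>\<^sup>k, \<gamma>\<^sup>k)\<close> were unbounded, its normalizations would cluster
at some \<open>(\<beta>, \<gamma>) \<noteq> 0\<close> that satisfies the C-type sign conditions and the homogeneous equation in \<open>y\<close>.
Pairing this equation with \<open>\<beta>\<close> gives \<open>\<beta>\<^sup>T (\<nabla>\<^sub>y \<L>) \<beta> + \<Sum>\<^sub>i \<gamma>\<^sub>i a\<^sub>i = 0\<close>. The first term is nonnegative,
since \<open>\<nabla>\<^sub>y \<L>\<close> is the Hessian of a convex function, and so is every summand of the second; hence
\<open>\<gamma>\<^sub>i a\<^sub>i = 0\<close> for all \<open>i\<close>. This is why the conditions with index m and with index c are equally good here: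
\<open>(\<beta>, \<gamma>)\<close> meets both sign conditions. The condition \<open>A\<^sub>2\<close> supplies the homogeneous equation in \<open>x\<close>, and
then \<open>A\<^sub>1\<close> gives the contradiction \<open>(\<beta>, \<gamma>) = 0\<close> (\<open>homogeneous_multipliers_vanish\<close>). Once \<open>(\<beta>\<^sup>k, \<gamma>\<^sup>k)\<close> is
bounded, so is \<open>\<alpha>\<^sup>k\<close> by upper-level regularity. The excess condition and compactness make
\<open>(y\<^sup>k, u\<^sup>k)\<close> cluster at a point of \<open>S_p\<close>, and passing to the limit (\<open>stationarity_in_the_limit\<close>)
gives the stationarity system there.\<close>

section \<open>Gradients of continuously differentiable functions\<close>

text \<open>Working with one gradient map instead of iterated directional derivatives lets continuity of all
partial gradients be read off from sections of a single continuous function.\<close>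

definition has_cont_grad :: "('a::euclidean_space \<Rightarrow> real) \<Rightarrow> bool" where
  "has_cont_grad h \<longleftrightarrow> (\<forall>z. GDERIV h z :> nabla h z) \<and> continuous_on UNIV (nabla h)"

lemma nabla_eqI:
  assumes "GDERIV h z :> d"
  shows "nabla h z = d"
  unfolding nabla_def
proof (rule the_equality)
  fix e assume "GDERIV h z :> e"
  then have "(\<lambda>v. v \<bullet> e) = (\<lambda>v. v \<bullet> d)"
    using assms has_derivative_unique unfolding gderiv_def by blast
  then show "e = d"
    by (metis inner_commute vector_eq_rdot)
qed (fact assms)

lemma has_cont_gradI:
  assumes "\<And>z. GDERIV h z :> D z" and "continuous_on UNIV D"
  shows "has_cont_grad h"
proof -
  have "nabla h = D"
    using assms(1) nabla_eqI by blast
  then show ?thesis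
    using assms by (simp add: has_cont_grad_def)
qed

lemma has_cont_gradD:
  assumes "has_cont_grad h"
  shows "GDERIV h z :> nabla h z"
  using assms by (simp add: has_cont_grad_def)

lemma has_cont_grad_tendsto:
  assumes "has_cont_grad h" and "(z \<longlongrightarrow> w) A"
  shows "((\<lambda>k. nabla h (z k)) \<longlongrightarrow> nabla h w) A"
proof -
  have "isCont (nabla h) w"
    using assms(1) by (simp add: has_cont_grad_def continuous_on_eq_continuous_at)
  then show ?thesis
    using assms(2) by (rule isCont_tendsto_compose)
qed

lemma has_cont_grad_cont: "has_cont_grad h \<Longrightarrow> continuous_on UNIV h"
  unfolding has_cont_grad_def gderiv_def
  by (meson continuous_at_imp_continuous_on has_derivative_continuous)

lemma cont_diff_one_imp_has_cont_grad:
  fixes h :: "'a::euclidean_space \<Rightarrow> real"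
  assumes "cont_diff (Suc 0) h"
  shows "has_cont_grad h"
proof (rule has_cont_gradI)
  let ?D = "\<lambda>z. \<Sum>b\<in>Basis. frechet_derivative h (at z) b *\<^sub>R b"
  show "GDERIV h z :> ?D z" for z
  proof -
    have d: "(h has_derivative frechet_derivative h (at z)) (at z)"
      using assms by (simp add: frechet_derivative_works)
    then interpret bounded_linear "frechet_derivative h (at z)"
      by (rule has_derivative_bounded_linear)
    have "frechet_derivative h (at z) = (\<lambda>v. v \<bullet> ?D z)"
    proof
      fix v
      have "frechet_derivative h (at z) v = frechet_derivative h (at z) (\<Sum>b\<in>Basis. (v \<bullet> b) *\<^sub>R b)"
        by (simp add: euclidean_representation)
      also have "\<dots> = v \<bullet> ?D z"
        by (simp add: sum scaleR inner_sum_right mult.commute)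
      finally show "frechet_derivative h (at z) v = v \<bullet> ?D z" .
    qed
    then show ?thesis
      using d unfolding gderiv_def by simp
  qed
  show "continuous_on UNIV ?D"
    using assms by (auto intro!: continuous_intros)
qed

lemma cont_diff_component:
  fixes h :: "'a::euclidean_space \<Rightarrow> real ^ 'k"
  shows "cont_diff k h \<Longrightarrow> cont_diff k (\<lambda>z. h z $ i)"
proof (induction k arbitrary: h)
  case 0
  then show ?case by (auto intro!: continuous_intros)
next
  case (Suc k)
  have d: "((\<lambda>z. h z $ i) has_derivative (\<lambda>v. frechet_derivative h (at z) v $ i)) (at z)" for z
    using Suc.prems
    by (intro bounded_linear.has_derivative[OF bounded_linear_vec_nth]) (simp add: frechet_derivative_works)
  then have "frechet_derivative (\<lambda>z. h z $ i) (at z) = (\<lambda>v. frechet_derivative h (at z) v $ i)" for z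
    by (metis frechet_derivative_at)
  then show ?case
    using d Suc by (auto simp: differentiable_def)
qed

lemma cont_diff_SucD: "cont_diff (Suc k) h \<Longrightarrow> cont_diff k h"
proof (induction k arbitrary: h)
  case 0
  then show ?case
    by (simp add: differentiable_imp_continuous_on differentiable_on_def)
next
  case (Suc k)
  then have "cont_diff k (\<lambda>z. frechet_derivative h (at z) v)" for v
    using Suc.IH by (metis cont_diff.simps(2))
  then show ?case
    using Suc.prems by simp
qed

lemma cont_diff_imp_has_cont_grad:
  fixes h :: "'a::euclidean_space \<Rightarrow> real"
  assumes "cont_diff k h" and "0 < k"
  shows "has_cont_grad h"
proof -
  have "cont_diff j h" if "j \<le> k" for j
    using that assms(1) by (induction rule: inc_induct) (auto dest: cont_diff_SucD simp del: cont_diff.simps)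
  then show ?thesis
    using assms(2) by (intro cont_diff_one_imp_has_cont_grad) (simp del: cont_diff.simps)
qed

lemma has_cont_grad_add:
  "has_cont_grad h \<Longrightarrow> has_cont_grad k \<Longrightarrow> has_cont_grad (\<lambda>z. h z + k z)"
  by (rule has_cont_gradI[where D="\<lambda>z. nabla h z + nabla k z"])
     (auto simp: has_cont_grad_def intro!: GDERIV_add continuous_intros)

lemma has_cont_grad_mult:
  assumes "has_cont_grad h" "has_cont_grad k"
  shows "has_cont_grad (\<lambda>z. h z * k z)"
  by (rule has_cont_gradI[where D="\<lambda>z. h z *\<^sub>R nabla k z + k z *\<^sub>R nabla h z"])
     (use assms in \<open>auto simp: has_cont_grad_def has_cont_grad_cont
       intro!: GDERIV_mult continuous_intros\<close>)

lemma has_cont_grad_const: "has_cont_grad (\<lambda>z. c)"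
  by (rule has_cont_gradI[where D="\<lambda>z. 0"]) (auto intro: GDERIV_const)

lemma has_cont_grad_sum:
  assumes "finite I" "\<And>i. i \<in> I \<Longrightarrow> has_cont_grad (h i)"
  shows "has_cont_grad (\<lambda>z. \<Sum>i\<in>I. h i z)"
  using assms by (induction rule: finite_induct) (auto intro: has_cont_grad_const has_cont_grad_add)

lemma has_cont_grad_inner: "has_cont_grad (\<lambda>z. z \<bullet> c)"
  by (rule has_cont_gradI[where D="\<lambda>z. c"])
     (auto simp: gderiv_def intro!: derivative_eq_intros)

lemma gderiv_section_fst:
  assumes "GDERIV h (x, y) :> d"
  shows "GDERIV (\<lambda>x'. h (x', y)) x :> fst d"
proof -
  have "((\<lambda>x'. h (x', y)) has_derivative (\<lambda>v. (v, 0) \<bullet> d)) (at x)"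
    using assms unfolding gderiv_def
    by (rule has_derivative_compose[rotated]) (auto intro!: derivative_eq_intros)
  then show ?thesis
    by (cases d) (simp add: gderiv_def)
qed

lemma gderiv_section_snd:
  assumes "GDERIV h (x, y) :> d"
  shows "GDERIV (\<lambda>y'. h (x, y')) y :> snd d"
proof -
  have "((\<lambda>y'. h (x, y')) has_derivative (\<lambda>v. (0, v) \<bullet> d)) (at y)"
    using assms unfolding gderiv_def
    by (rule has_derivative_compose[rotated]) (auto intro!: derivative_eq_intros)
  then show ?thesis
    by (cases d) (simp add: gderiv_def)
qed

text \<open>A partial gradient is a projection of the full gradient; this is how joint continuity of the full
gradient becomes continuity of partial gradients along sequences in which all variables move.\<close>

lemma nabla_fst: "has_cont_grad h \<Longrightarrow> nabla (\<lambda>x'. h (x', y)) x = fst (nabla h (x, y))"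
  by (intro nabla_eqI gderiv_section_fst has_cont_gradD)

lemma nabla_snd: "has_cont_grad h \<Longrightarrow> nabla (\<lambda>y'. h (x, y')) y = snd (nabla h (x, y))"
  by (intro nabla_eqI gderiv_section_snd has_cont_gradD)

lemma nabla_snd_fst:
  assumes "has_cont_grad h"
  shows "nabla (\<lambda>y'. h (x, y', u)) y = fst (snd (nabla h (x, y, u)))"
  using gderiv_section_fst[OF gderiv_section_snd[OF has_cont_gradD[OF assms]]]
  by (rule nabla_eqI)

lemma nabla_fst_snd_fst:
  assumes "has_cont_grad h"
  shows "nabla (\<lambda>(x', y'). h (x', y', u)) (x, y) =
           (fst (nabla h (x, y, u)), fst (snd (nabla h (x, y, u))))"
proof (rule nabla_eqI)
  let ?d = "nabla h (x, y, u)"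
  have "((\<lambda>p. h (fst p, snd p, u)) has_derivative (\<lambda>v. (fst v, snd v, 0) \<bullet> ?d)) (at (x, y))"
    by (rule has_derivative_compose[of "\<lambda>p. (fst p, snd p, u)" _ _ _ h])
       (use has_cont_gradD[OF assms, of "(x, y, u)"] in
         \<open>auto simp: gderiv_def intro!: derivative_eq_intros\<close>)
  moreover have "(fst v, snd v, 0) \<bullet> ?d = v \<bullet> (fst ?d, fst (snd ?d))" for v
    by (cases v; cases ?d) (auto simp: inner_prod_def)
  ultimately show "GDERIV (\<lambda>(x', y'). h (x', y', u)) (x, y) :> (fst ?d, fst (snd ?d))"
    by (simp add: gderiv_def case_prod_beta')
qed

lemma has_cont_grad_forget:
  fixes h :: "'a::euclidean_space \<times> 'b::euclidean_space \<Rightarrow> real"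
  assumes "has_cont_grad h"
  shows "has_cont_grad (\<lambda>(x, y, u :: 'c::euclidean_space). h (x, y))"
proof (rule has_cont_gradI)
  let ?D = "\<lambda>(x, y, u). (fst (nabla h (x, y)), snd (nabla h (x, y)), 0)"
  show "GDERIV (\<lambda>(x, y, u). h (x, y)) z :> ?D z" for z
  proof -
    obtain x y u where z: "z = (x, y, u)"
      by (cases z) auto
    have "((\<lambda>p. h (fst p, fst (snd p))) has_derivative (\<lambda>v. (fst v, fst (snd v)) \<bullet> nabla h (x, y))) (at z)"
      by (rule has_derivative_compose[of "\<lambda>p. (fst p, fst (snd p))" _ _ _ h])
         (use has_cont_gradD[OF assms, of "(x, y)"] z in
           \<open>auto simp: gderiv_def intro!: derivative_eq_intros\<close>)
    also have "(\<lambda>v. (fst v, fst (snd v)) \<bullet> nabla h (x, y)) = (\<lambda>v. v \<bullet> ?D z)"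
      by (auto simp: fun_eq_iff inner_prod_def z)
    finally show ?thesis
      by (simp add: gderiv_def case_prod_beta')
  qed
  have "continuous_on UNIV (nabla h)"
    using assms by (simp add: has_cont_grad_def)
  then have "continuous_on UNIV (\<lambda>z. nabla h (fst z, fst (snd z)))"
    by (rule continuous_on_compose2) (auto intro!: continuous_intros)
  then show "continuous_on UNIV ?D"
    by (auto simp: case_prod_beta' intro!: continuous_intros)
qed

section \<open>Partial derivatives of the relaxation functions\<close>

text \<open>The tool for differentiating piecewise functions: at points outside a closed piece the
  derivative within that piece holds vacuously, so derivatives along finitely many closed pieces that
  cover the line combine to a derivative at every point.\<close>

lemma has_real_derivative_closed_piece:
  fixes f g :: "real \<Rightarrow> real"
  assumes "closed P" and eq: "\<And>r. r \<in> P \<Longrightarrow> g r = f r"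
    and f: "s \<in> P \<Longrightarrow> (f has_real_derivative D) (at s within P)"
  shows "(g has_real_derivative D) (at s within P)"
proof (cases "s \<in> P")
  case True
  then show ?thesis
    using has_derivative_transform[OF True eq] f by (simp add: has_field_derivative_def)
next
  case False
  then show ?thesis
    using assms(1) not_in_closure_trivial_limitI[of s P] by (simp add: has_field_derivative_iff)
qed

text \<open>Continuing \<open>\<theta>\<close> by the absolute value outside \<open>[-1, 1]\<close> merges the three branches of the
Steffensen-Ulbrich function into one formula; the end point conditions on \<open>\<theta>\<close> make the
continuation differentiable.\<close>

definition reg_extend :: "(real \<Rightarrow> real) \<Rightarrow> real \<Rightarrow> real" where
  "reg_extend \<theta> s = (if s \<in> {-1..1} then \<theta> s else \<bar>s\<bar>)"

definition reg_slope :: "(real \<Rightarrow> real) \<Rightarrow> real \<Rightarrow> real" where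
  "reg_slope \<theta> s = deriv (reg_extend \<theta>) s"

text \<open>Strict monotonicity of \<open>\<theta>'\<close> confines the slope to \<open>[-1, 1]\<close>. Hence \<open>\<theta> s + s\<close> increases from \<open>0\<close> to \<open>2\<close>
and \<open>\<theta> s - s\<close> decreases from \<open>2\<close> to \<open>0\<close>, which gives the two estimates of \<open>\<theta>\<close>.\<close>

lemma reg_extend_properties:
  assumes "regularization_function \<theta>"
  shows "DERIV (reg_extend \<theta>) s :> reg_slope \<theta> s"
    and "s \<ge> 1 \<Longrightarrow> reg_slope \<theta> s = 1"
    and "s \<le> -1 \<Longrightarrow> reg_slope \<theta> s = -1"
    and "\<bar>s\<bar> < 1 \<Longrightarrow> \<bar>reg_slope \<theta> s\<bar> \<le> 1"
    and "\<bar>s\<bar> < 1 \<Longrightarrow> \<bar>s\<bar> < \<theta> s"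
    and "\<bar>s\<bar> < 1 \<Longrightarrow> \<theta> s + \<bar>s\<bar> \<le> 2"
proof -
  obtain \<theta>' \<theta>'' where
    d1: "\<And>s. s \<in> {-1..1} \<Longrightarrow> (\<theta> has_real_derivative \<theta>' s) (at s within {-1..1})" and
    d2: "\<And>s. s \<in> {-1..1} \<Longrightarrow> (\<theta>' has_real_derivative \<theta>'' s) (at s within {-1..1})" and
    ends: "\<theta> (-1) = 1" "\<theta> 1 = 1" "\<theta>' (-1) = -1" "\<theta>' 1 = 1" and
    pos: "\<And>s. s \<in> {-1<..<1} \<Longrightarrow> \<theta>'' s > 0"
    using assms unfolding regularization_function_def by blast
  have int: "at s within {-1..1} = at s" if "\<bar>s\<bar> < 1" for s :: real
    using that by (intro at_within_interior) auto
  have d1': "DERIV \<theta> s :> \<theta>' s" and d2': "DERIV \<theta>' s :> \<theta>'' s" if "\<bar>s\<bar> < 1" for s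
    using d1[of s] d2[of s] int[OF that] that by (auto simp: abs_le_iff abs_less_iff)
  have cont: "continuous_on {-1..1} \<theta>" "continuous_on {-1..1} \<theta>'"
    using d1 d2 by (meson DERIV_continuous continuous_on_eq_continuous_within)+
  have mono: "\<theta>' a < \<theta>' b" if "-1 \<le> a" "a < b" "b \<le> 1" for a b
  proof (rule DERIV_pos_imp_increasing_open[OF that(2)])
    show "\<exists>y. DERIV \<theta>' s :> y \<and> 0 < y" if "a < s" "s < b" for s
      using d2'[of s] pos[of s] that \<open>-1 \<le> a\<close> \<open>b \<le> 1\<close> by (intro exI[of _ "\<theta>'' s"]) auto
    show "continuous_on {a..b} \<theta>'"
      using cont(2) by (rule continuous_on_subset) (use that in auto)
  qed
  have slope: "-1 < \<theta>' s" "\<theta>' s < 1" if "\<bar>s\<bar> < 1" for s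
    using mono[of "-1" s] mono[of s 1] that ends by auto
  have up: "\<theta> a + a < \<theta> b + b" if "-1 \<le> a" "a < b" "b \<le> 1" for a b
  proof (rule DERIV_pos_imp_increasing_open[OF that(2)])
    fix s assume "a < s" "s < b"
    then have s: "\<bar>s\<bar> < 1"
      using that by auto
    have "((\<lambda>s. \<theta> s + s) has_real_derivative \<theta>' s + 1) (at s)"
      by (intro DERIV_add d1'[OF s] DERIV_ident)
    then show "\<exists>y. ((\<lambda>s. \<theta> s + s) has_real_derivative y) (at s) \<and> 0 < y"
      using slope[OF s] by (intro exI[of _ "\<theta>' s + 1"]) auto
    next
    show "continuous_on {a..b} (\<lambda>s. \<theta> s + s)"
      by (intro continuous_intros continuous_on_subset[OF cont(1)]) (use that in auto)
  qed
  have down: "\<theta> a - a > \<theta> b - b" if "-1 \<le> a" "a < b" "b \<le> 1" for a b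
  proof (rule DERIV_neg_imp_decreasing_open[OF that(2)])
    fix s assume "a < s" "s < b"
    then have s: "\<bar>s\<bar> < 1"
      using that by auto
    have "((\<lambda>s. \<theta> s - s) has_real_derivative \<theta>' s - 1) (at s)"
      by (intro DERIV_diff d1'[OF s] DERIV_ident)
    then show "\<exists>y. ((\<lambda>s. \<theta> s - s) has_real_derivative y) (at s) \<and> y < 0"
      using slope[OF s] by (intro exI[of _ "\<theta>' s - 1"]) auto
    next
    show "continuous_on {a..b} (\<lambda>s. \<theta> s - s)"
      by (intro continuous_intros continuous_on_subset[OF cont(1)]) (use that in auto)
  qed
  let ?D = "\<lambda>s. if s \<in> {-1..1} then \<theta>' s else sgn s"
  have D: "DERIV (reg_extend \<theta>) s :> ?D s" for s
  proof -
    \<comment> \<open>The value at the two junction points comes from the conditions on the end point slopes.\<close>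
    have "(reg_extend \<theta> has_real_derivative ?D s) (at s within {-1..1})"
    proof (rule has_real_derivative_closed_piece[of _ _ \<theta>])
      show "s \<in> {-1..1} \<Longrightarrow> (\<theta> has_real_derivative ?D s) (at s within {-1..1})"
        using d1[of s] by simp
    qed (simp_all add: reg_extend_def)
    moreover have "(reg_extend \<theta> has_real_derivative ?D s) (at s within {1..})"
    proof (rule has_real_derivative_closed_piece[of _ _ "\<lambda>s. s"])
      assume "s \<in> {1..}"
      then have "?D s = 1"
        using ends by (cases "s = 1") auto
      then show "((\<lambda>s. s) has_real_derivative ?D s) (at s within {1..})"
        by (simp only: DERIV_ident)
    qed (use ends in \<open>auto simp: reg_extend_def\<close>)
    moreover have "(reg_extend \<theta> has_real_derivative ?D s) (at s within {..-1})"
    proof (rule has_real_derivative_closed_piece[of _ _ "\<lambda>s. - s"])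
      assume "s \<in> {..-1}"
      then have "?D s = -1"
        using ends by (cases "s = -1") auto
      then show "((\<lambda>s. - s) has_real_derivative ?D s) (at s within {..-1})"
        using DERIV_minus[OF DERIV_ident] by metis
    qed (use ends in \<open>auto simp: reg_extend_def\<close>)
    ultimately have "(reg_extend \<theta> has_real_derivative ?D s) (at s within {-1..1} \<union> {1..} \<union> {..-1})"
      by (simp add: has_field_derivative_iff Lim_within_Un)
    also have "{-1..1} \<union> {1..} \<union> {..-1} = (UNIV :: real set)"
      by auto
    finally show ?thesis .
  qed
  then have slope_eq: "reg_slope \<theta> s = ?D s" for s
    unfolding reg_slope_def by (rule DERIV_imp_deriv)
  show "DERIV (reg_extend \<theta>) s :> reg_slope \<theta> s"
    using D slope_eq by simp
  show "s \<ge> 1 \<Longrightarrow> reg_slope \<theta> s = 1" "s \<le> -1 \<Longrightarrow> reg_slope \<theta> s = -1"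
    using ends by (auto simp: slope_eq)
  assume s: "\<bar>s\<bar> < 1"
  show "\<bar>reg_slope \<theta> s\<bar> \<le> 1"
    using s slope[OF s] by (auto simp: slope_eq)
  show "\<bar>s\<bar> < \<theta> s" "\<theta> s + \<bar>s\<bar> \<le> 2"
    using s up[of "-1" s] up[of s 1] down[of "-1" s] down[of s 1] by (simp_all add: ends abs_less_iff)
qed

lemma phi_SU_altdef:
  assumes "regularization_function \<theta>" "t > 0"
  shows "phi_SU \<theta> t g u = u - g - t * reg_extend \<theta> ((u + g) / t)"
proof -
  define s where "s = (u + g) / t"
  have ends: "\<theta> (-1) = 1" "\<theta> 1 = 1"
    using assms(1) unfolding regularization_function_def by auto
  have ug: "u + g = t * s"
    using assms(2) by (simp add: s_def)
  have gu: "g + u = t * s"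
    using ug by linarith
  consider "s \<le> -1" | "s \<ge> 1" | "-1 < s" "s < 1"
    by linarith
  then have "phi_SU \<theta> t g u = u - g - t * reg_extend \<theta> s"
  proof cases
    case 1
    then have "t * s \<le> t * (-1)"
      using assms(2) by (intro mult_left_mono) auto
    moreover have "reg_extend \<theta> s = - s"
      using 1 ends by (cases "s = -1") (auto simp: reg_extend_def)
    ultimately show ?thesis
      using ug by (simp add: phi_SU_def gu)
  next
    case 2
    then have "t * 1 \<le> t * s"
      using assms(2) by (intro mult_left_mono) auto
    moreover have "reg_extend \<theta> s = s"
      using 2 ends by (cases "s = 1") (auto simp: reg_extend_def)
    moreover have "\<not> t * s \<le> - t"
      using \<open>t * 1 \<le> t * s\<close> assms(2) by linarith
    ultimately show ?thesis
      using ug by (simp add: phi_SU_def gu)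
  next
    case 3
    then have "\<not> t * s \<le> - t" "\<not> t \<le> t * s"
      using mult_strict_left_mono[OF 3(1) assms(2)] mult_strict_left_mono[OF 3(2) assms(2)] by auto
    then show ?thesis
      using 3 by (simp add: phi_SU_def reg_extend_def gu s_def[symmetric])
  qed
  then show ?thesis
    by (simp add: s_def)
qed

text \<open>With \<open>p = u - t\<close> and \<open>q = - g - t\<close> this is \<open>p q = ((p + q)\<^sup>2 - p\<^sup>2 - q\<^sup>2) / 2\<close>; in the other branch, where
\<open>p + q < 0\<close>, the term \<open>(p + q)\<^sup>2\<close> is dropped. The form makes differentiability across the branches visible.\<close>

lemma phi_KS_altdef:
  "phi_KS t g u = ((max 0 (u - g - 2 * t))\<^sup>2 - (u - t)\<^sup>2 - (- g - t)\<^sup>2) / 2"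
proof (cases "u - g \<ge> 2 * t")
  case True
  then have "max 0 (u - g - 2 * t) = u - g - 2 * t"
    by simp
  then show ?thesis
    using True by (simp add: phi_KS_def power2_eq_square algebra_simps)
next
  case False
  then have "max 0 (u - g - 2 * t) = 0"
    by simp
  then show ?thesis
    using False by (simp add: phi_KS_def add_divide_distrib diff_divide_distrib)
qed

lemma DERIV_max_power2: "((\<lambda>s::real. (max 0 s)\<^sup>2) has_real_derivative 2 * max 0 s) (at s)"
proof -
  have "((\<lambda>s. (max 0 s)\<^sup>2) has_real_derivative 2 * max 0 s) (at s within {..0})"
    by (rule has_real_derivative_closed_piece[of _ _ "\<lambda>s. 0"]) (simp_all add: max_absorb1)
  moreover have "((\<lambda>s. (max 0 s)\<^sup>2) has_real_derivative 2 * max 0 s) (at s within {0..})"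
  proof (rule has_real_derivative_closed_piece[of _ _ "\<lambda>s. s * s"])
    assume "s \<in> {0..}"
    then have "2 * max 0 s = 1 * s + 1 * s"
      by simp
    then show "((\<lambda>s. s * s) has_real_derivative 2 * max 0 s) (at s within {0..})"
      using DERIV_mult[OF DERIV_ident DERIV_ident, of s "{0..}"] by simp
  qed (simp_all add: max_absorb2 power2_eq_square)
  ultimately have "((\<lambda>s. (max 0 s)\<^sup>2) has_real_derivative 2 * max 0 s) (at s within {..0} \<union> {0..})"
    by (simp add: has_field_derivative_iff Lim_within_Un)
  also have "{..0} \<union> {0..} = (UNIV :: real set)"
    by auto
  finally show ?thesis .
qed

text \<open>The derivative with respect to \<open>g\<^sub>i\<close> comes first. In the last entry for Kanzow-Schwartz the positive
part is half the derivative of its square.\<close>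

fun phi_grad_list :: "relaxation \<Rightarrow> (real \<Rightarrow> real) \<Rightarrow> real \<Rightarrow> (real \<Rightarrow> real \<Rightarrow> real \<times> real) list" where
  "phi_grad_list Scholtes \<theta> t =
     [\<lambda>g u. (1, 0), \<lambda>g u. (0, -1), \<lambda>g u. (- u, - g)]"
| "phi_grad_list Lin_Fukushima \<theta> t =
     [\<lambda>g u. (- u, - g), \<lambda>g u. (u + t, g - t)]"
| "phi_grad_list Kadrani_Dussault_Benchakroun \<theta> t =
     [\<lambda>g u. (1, 0), \<lambda>g u. (0, -1), \<lambda>g u. (t - u, - g - t)]"
| "phi_grad_list Steffensen_Ulbrich \<theta> t =
     [\<lambda>g u. (1, 0), \<lambda>g u. (0, -1),
      \<lambda>g u. (- 1 - reg_slope \<theta> ((u + g) / t), 1 - reg_slope \<theta> ((u + g) / t))]"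
| "phi_grad_list Kanzow_Schwartz \<theta> t =
     [\<lambda>g u. (1, 0), \<lambda>g u. (0, -1),
      \<lambda>g u. (- g - t - max 0 (u - g - 2 * t), max 0 (u - g - 2 * t) - (u - t))]"

lemma phi_list_gderiv:
  assumes reg: "regularization_function \<theta>" and t: "t > 0" and j: "j < length (phi_list R \<theta> t)"
  shows "GDERIV (\<lambda>(g, u). (phi_list R \<theta> t ! j) g u) (g, u) :> (phi_grad_list R \<theta> t ! j) g u"
proof -
  have SU: "((\<lambda>p. phi_SU \<theta> t (fst p) (snd p)) has_derivative
      (\<lambda>h. h \<bullet> (- 1 - reg_slope \<theta> ((u + g) / t), 1 - reg_slope \<theta> ((u + g) / t)))) (at (g, u))"
  proof -
    have lin: "((\<lambda>p. (snd p + fst p) / t) has_derivative (\<lambda>h. (snd h + fst h) / t)) (at (g, u))"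
      using t by (auto intro!: derivative_eq_intros)
    have "((\<lambda>p. reg_extend \<theta> ((snd p + fst p) / t)) has_derivative
             (\<lambda>h. reg_slope \<theta> ((u + g) / t) * ((snd h + fst h) / t))) (at (g, u))"
      using has_derivative_compose[OF lin, of "reg_extend \<theta>"]
        reg_extend_properties(1)[OF reg, of "(u + g) / t"]
      by (simp add: has_field_derivative_def del: times_divide_eq_right)
    then have "((\<lambda>p. snd p - fst p - t * reg_extend \<theta> ((snd p + fst p) / t)) has_derivative
        (\<lambda>h. snd h - fst h - reg_slope \<theta> ((u + g) / t) * (snd h + fst h))) (at (g, u))"
      using t by (auto intro!: derivative_eq_intros)
    then show ?thesis
      by (simp add: phi_SU_altdef[OF reg t] inner_prod_def algebra_simps)
  qed
  have KS: "((\<lambda>p. phi_KS t (fst p) (snd p)) has_derivative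
      (\<lambda>h. h \<bullet> (- g - t - max 0 (u - g - 2 * t), max 0 (u - g - 2 * t) - (u - t)))) (at (g, u))"
  proof -
    let ?m = "max 0 (u - g - 2 * t)"
    have lin: "((\<lambda>p. snd p - fst p - 2 * t) has_derivative (\<lambda>h. snd h - fst h)) (at (g, u))"
      by (auto intro!: derivative_eq_intros)
    have sq: "((\<lambda>p. (max 0 (snd p - fst p - 2 * t))\<^sup>2) has_derivative
             (\<lambda>h. 2 * ?m * (snd h - fst h))) (at (g, u))"
      using has_derivative_compose[OF lin, of "\<lambda>s. (max 0 s)\<^sup>2"] DERIV_max_power2[of "u - g - 2 * t"]
      by (simp add: has_field_derivative_def)
    have sqs: "((\<lambda>p. (snd p - t)\<^sup>2) has_derivative (\<lambda>h. 2 * (u - t) * snd h)) (at (g, u))"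
      "((\<lambda>p. (- fst p - t)\<^sup>2) has_derivative (\<lambda>h. 2 * (- g - t) * (- fst h))) (at (g, u))"
      unfolding power2_eq_square by (rule derivative_eq_intros refl | simp add: fun_eq_iff)+
    have "(\<lambda>p. phi_KS t (fst p) (snd p)) = (\<lambda>p. 1 / 2 *
        ((max 0 (snd p - fst p - 2 * t))\<^sup>2 - (snd p - t)\<^sup>2 - (- fst p - t)\<^sup>2))"
      by (simp add: fun_eq_iff phi_KS_altdef)
    moreover have "(\<lambda>h. h \<bullet> (- g - t - ?m, ?m - (u - t))) = (\<lambda>h. 1 / 2 *
        (2 * ?m * (snd h - fst h) - 2 * (u - t) * snd h - 2 * (- g - t) * (- fst h)))"
      by (simp add: fun_eq_iff inner_prod_def algebra_simps)
    moreover note has_derivative_mult_right[OF has_derivative_diff[OF has_derivative_diff[OF sq sqs(1)] sqs(2)],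
        of "1 / 2"]
    ultimately show ?thesis
      by (simp only:)
  qed
  have lin: "((\<lambda>p. fst p) has_derivative (\<lambda>h. h \<bullet> (1, 0))) (at (g, u))"
    "((\<lambda>p. - snd p) has_derivative (\<lambda>h. h \<bullet> (0, -1))) (at (g, u))"
    "((\<lambda>p. fst p - t) has_derivative (\<lambda>h. h \<bullet> (1, 0))) (at (g, u))"
    "((\<lambda>p. - snd p - t) has_derivative (\<lambda>h. h \<bullet> (0, -1))) (at (g, u))"
    by (auto intro!: derivative_eq_intros)
  have prod: "((\<lambda>p. (a * snd p + b) * (c * fst p + d) + e) has_derivative
      (\<lambda>h. h \<bullet> ((a * u + b) * c, a * (c * g + d)))) (at (g, u))" for a b c d e :: real
  proof -
    have "((\<lambda>p. a * snd p + b) has_derivative (\<lambda>h. a * snd h)) (at (g, u))"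
      "((\<lambda>p. c * fst p + d) has_derivative (\<lambda>h. c * fst h)) (at (g, u))"
      by (auto intro!: derivative_eq_intros)
    from has_derivative_add_const[OF has_derivative_mult[OF this], of e]
    show ?thesis
      by (simp add: inner_prod_def mult_ac)
  qed
  have bil: "((\<lambda>p. - snd p * fst p - t) has_derivative (\<lambda>h. h \<bullet> (- u, - g))) (at (g, u))"
    "((\<lambda>p. - (snd p * fst p + t\<^sup>2)) has_derivative (\<lambda>h. h \<bullet> (- u, - g))) (at (g, u))"
    "((\<lambda>p. - (snd p + t) * (- fst p + t) + t\<^sup>2) has_derivative (\<lambda>h. h \<bullet> (u + t, g - t))) (at (g, u))"
    "((\<lambda>p. - (snd p - t) * (fst p + t)) has_derivative (\<lambda>h. h \<bullet> (t - u, - g - t))) (at (g, u))"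
    using prod[of "-1" 0 1 0 "- t"] prod[of "-1" 0 1 0 "- t\<^sup>2"] prod[of "-1" "-t" "-1" t "t\<^sup>2"]
      prod[of "-1" t 1 t 0]
    by (simp_all add: add.commute[of u t] del: inner_Pair)
  show ?thesis
    unfolding gderiv_def case_prod_beta'
    using j lin bil SU KS by (cases R) (auto simp: less_Suc_eq simp del: inner_Pair)
qed

section \<open>Signs of the multipliers of one relaxed constraint\<close>

text \<open>Only active components contribute to \<open>\<gamma>\<close> and \<open>a\<close>, and the geometry of the relaxed feasible set in the
\<open>(g, u)\<close>-plane leaves few combinations. On a hyperbola-like piece (Scholtes, Lin-Fukushima,
Steffensen-Ulbrich) \<open>\<gamma>\<close> and \<open>a\<close> have the same sign, and either \<open>a (u + s) = \<gamma> (s - g)\<close> with \<open>s = 0\<close> or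
\<open>s = t\<close>, or \<open>u\<close> and \<open>- g\<close> are at most \<open>t\<close>. On a piece consisting of two segments
(Kadrani-Dussault-Benchakroun, Kanzow-Schwartz) the normal is parallel to an axis, so that the
product can only be positive at a corner, where both components are negative.\<close>

lemma relaxation_multiplier_signs:
  fixes R :: relaxation and \<theta> :: "real \<Rightarrow> real" and t g u :: real and \<mu> :: "nat \<Rightarrow> real"
  defines "I \<equiv> phi_idx R \<theta> t"
  defines "\<gamma> \<equiv> - (\<Sum>j\<in>I. \<mu> j * fst ((phi_grad_list R \<theta> t ! j) g u))"
    and "a \<equiv> \<Sum>j\<in>I. \<mu> j * snd ((phi_grad_list R \<theta> t ! j) g u)"
  assumes reg: "regularization_function \<theta>" and t: "t > 0"
    and kkt: "\<And>j. j \<in> I \<Longrightarrow>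
      \<mu> j \<ge> 0 \<and> (phi_list R \<theta> t ! j) g u \<le> 0 \<and> \<mu> j * (phi_list R \<theta> t ! j) g u = 0"
  shows "\<bar>a * u + \<gamma> * g\<bar> \<le> t * (\<bar>a\<bar> + \<bar>\<gamma>\<bar>)"
    and "c_sign \<gamma> a"
    and "R \<in> {Kadrani_Dussault_Benchakroun, Kanzow_Schwartz} \<Longrightarrow> m_sign \<gamma> a"
proof -
  have bound: "\<bar>a * u + \<gamma> * g\<bar> \<le> t * (\<bar>a\<bar> + \<bar>\<gamma>\<bar>)"
    if "a = 0 \<or> \<bar>u\<bar> \<le> t" "\<gamma> = 0 \<or> \<bar>g\<bar> \<le> t"
  proof -
    have "\<bar>a * u\<bar> \<le> t * \<bar>a\<bar>" "\<bar>\<gamma> * g\<bar> \<le> t * \<bar>\<gamma>\<bar>"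
      using that by (auto simp: abs_mult mult.commute[of t] mult_left_mono)
    then show ?thesis
      using abs_triangle_ineq[of "a * u" "\<gamma> * g"] by (simp add: distrib_left)
  qed
  have zero: "\<bar>a * u + \<gamma> * g\<bar> \<le> t * (\<bar>a\<bar> + \<bar>\<gamma>\<bar>)" if "a * u + \<gamma> * g = 0"
    using that t by simp
  have "\<bar>a * u + \<gamma> * g\<bar> \<le> t * (\<bar>a\<bar> + \<bar>\<gamma>\<bar>) \<and> c_sign \<gamma> a \<and>
      (R \<in> {Kadrani_Dussault_Benchakroun, Kanzow_Schwartz} \<longrightarrow> m_sign \<gamma> a)"
  proof (cases R)
    case Scholtes
    have k: "\<mu> 0 \<ge> 0" "\<mu> 1 \<ge> 0" "\<mu> 2 \<ge> 0" "g \<le> 0" "u \<ge> 0"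
      "\<mu> 0 = 0 \<or> g = 0" "\<mu> 1 = 0 \<or> u = 0" "\<mu> 2 = 0 \<or> u * g = - t"
      using kkt[of 0] kkt[of 1] kkt[of 2] by (auto simp: I_def Scholtes)
    have ga: "\<gamma> = - \<mu> 0 + \<mu> 2 * u" "a = - \<mu> 1 - \<mu> 2 * g"
      by (auto simp: \<gamma>_def a_def I_def Scholtes numeral_eq_Suc lessThan_Suc)
    show ?thesis
    proof (cases "\<mu> 2 = 0")
      case True
      then show ?thesis
        using k t ga by (auto simp: c_sign_def Scholtes)
    next
      case False
      then have "u * g < 0"
        using k t by auto
      then have "\<mu> 0 = 0" "\<mu> 1 = 0"
        using k by auto
      then have "\<gamma> = \<mu> 2 * u" "a = \<mu> 2 * (- g)"
        using ga by simp_all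
      moreover from this have "\<gamma> \<ge> 0" "a \<ge> 0"
        using k by (auto intro: mult_nonneg_nonneg simp: mult_nonneg_nonpos)
      ultimately show ?thesis
        using zero by (simp add: c_sign_def Scholtes mult_nonneg_nonpos)
    qed
  next
    case Lin_Fukushima
    have second: "(phi_list R \<theta> t ! 1) g u = t\<^sup>2 - (u + t) * (t - g)"
      by (simp add: Lin_Fukushima algebra_simps)
    have k: "\<mu> 0 \<ge> 0" "\<mu> 1 \<ge> 0" "u * g \<ge> - t\<^sup>2" "(u + t) * (t - g) \<ge> t\<^sup>2"
      "\<mu> 0 = 0 \<or> u * g = - t\<^sup>2" "\<mu> 1 = 0 \<or> (u + t) * (t - g) = t\<^sup>2"
      using kkt[of 0] kkt[of 1, unfolded second]
      by (auto simp: I_def Lin_Fukushima minus_add_distrib eq_neg_iff_add_eq_0)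
    have ga: "\<gamma> = \<mu> 0 * u - \<mu> 1 * (u + t)" "a = - \<mu> 0 * g - \<mu> 1 * (t - g)"
      by (auto simp: \<gamma>_def a_def I_def Lin_Fukushima numeral_eq_Suc lessThan_Suc algebra_simps)
    \<comment> \<open>The two hyperbolas do not meet: a common point would give \<open>u\<^sup>2 + u t + t\<^sup>2 = 0\<close>.\<close>
    have "\<mu> 0 = 0 \<or> \<mu> 1 = 0"
    proof (rule ccontr)
      assume "\<not> ?thesis"
      then have e: "u * g = - t\<^sup>2" "(u + t) * (t - g) = t\<^sup>2"
        using k by auto
      then have "t * (u - g) = t * (- t)"
        by (simp add: algebra_simps power2_eq_square)
      then have "u - g = - t"
        using t by (simp only: mult_cancel_left) simp
      then have "g = u + t"
        by simp
      then have "u * u + u * t + t * t = 0"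
        using e by (simp add: algebra_simps power2_eq_square)
      then have "(u + t / 2)\<^sup>2 + 3 / 4 * t\<^sup>2 = 0"
        by (simp add: power2_eq_square algebra_simps)
      then show False
        using t zero_less_power2[of t] zero_le_power2[of "u + t / 2"] by linarith
    qed
    then show ?thesis
    proof
      assume m: "\<mu> 0 = 0"
      have ga': "\<gamma> = - \<mu> 1 * (u + t)" "a = - \<mu> 1 * (t - g)"
        using ga m by simp_all
      have "\<gamma> * a = (\<mu> 1)\<^sup>2 * ((u + t) * (t - g))"
        unfolding ga' by (simp add: power2_eq_square algebra_simps)
      moreover have "(u + t) * (t - g) \<ge> 0"
        using k(4) zero_le_power2[of t] by linarith
      ultimately have "c_sign \<gamma> a"
        by (simp only: c_sign_def mult_nonneg_nonneg zero_le_power2)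
      moreover have "a * u + \<gamma> * g = t * (\<gamma> - a)"
        unfolding ga' by (simp add: algebra_simps)
      then have "\<bar>a * u + \<gamma> * g\<bar> \<le> t * (\<bar>a\<bar> + \<bar>\<gamma>\<bar>)"
        using t mult_left_mono[of "\<bar>\<gamma> - a\<bar>" "\<bar>a\<bar> + \<bar>\<gamma>\<bar>" t]
        by (simp only: abs_mult) linarith
      ultimately show ?thesis
        by (simp add: Lin_Fukushima)
    next
      assume m: "\<mu> 1 = 0"
      have ga': "\<gamma> = \<mu> 0 * u" "a = - \<mu> 0 * g"
        using ga m by simp_all
      have "\<gamma> * a = (\<mu> 0)\<^sup>2 * (- (u * g))"
        unfolding ga' by (simp add: power2_eq_square algebra_simps)
      moreover have "(\<mu> 0)\<^sup>2 * (- (u * g)) \<ge> 0"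
        using k(5) by auto
      ultimately have "c_sign \<gamma> a"
        by (simp only: c_sign_def)
      moreover have "a * u + \<gamma> * g = 0"
        unfolding ga' by (simp add: algebra_simps)
      ultimately show ?thesis
        using zero by (simp add: Lin_Fukushima)
    qed
  next
    case Kadrani_Dussault_Benchakroun
    have k: "\<mu> 0 \<ge> 0" "\<mu> 1 \<ge> 0" "\<mu> 2 \<ge> 0" "g \<le> t" "u \<ge> - t"
      "\<mu> 0 = 0 \<or> g = t" "\<mu> 1 = 0 \<or> u = - t" "\<mu> 2 = 0 \<or> u = t \<or> g = - t"
      using kkt[of 0] kkt[of 1] kkt[of 2] by (auto simp: I_def Kadrani_Dussault_Benchakroun)
    have ga: "\<gamma> = - \<mu> 0 + \<mu> 2 * (u - t)" "a = - \<mu> 1 - \<mu> 2 * (g + t)"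
      by (auto simp: \<gamma>_def a_def I_def Kadrani_Dussault_Benchakroun numeral_eq_Suc lessThan_Suc algebra_simps)
    consider "\<mu> 2 = 0" | "u = t" | "g = - t"
      using k by blast
    then show ?thesis
    proof cases
      case 1
      then have "\<gamma> \<le> 0" "a \<le> 0"
        using k ga by auto
      then have "m_sign \<gamma> a" "c_sign \<gamma> a"
        by (auto simp: m_sign_def c_sign_def mult_nonpos_nonpos)
      then show ?thesis
        using bound k ga t 1 by fastforce
    next
      case 2
      then have "\<gamma> = - \<mu> 0" "\<mu> 1 = 0"
        using k ga t by auto
      moreover have "\<mu> 2 * (g + t) \<ge> 0" if "\<mu> 0 \<noteq> 0"
        using that k t by auto
      ultimately have "\<gamma> = 0 \<or> \<gamma> \<le> 0 \<and> a \<le> 0"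
        using ga k by auto
      then have "m_sign \<gamma> a" "c_sign \<gamma> a"
        by (auto simp: m_sign_def c_sign_def mult_nonpos_nonpos)
      moreover have "\<gamma> = 0 \<or> \<bar>g\<bar> \<le> t"
        using \<open>\<gamma> = - \<mu> 0\<close> k t by auto
      ultimately show ?thesis
        using bound 2 t by auto
    next
      case 3
      then have "a = - \<mu> 1" "\<mu> 0 = 0"
        using k ga t by auto
      moreover have "\<mu> 2 * (u - t) \<le> 0" if "\<mu> 1 \<noteq> 0"
        using that k t by (auto simp: mult_nonneg_nonpos)
      ultimately have "a = 0 \<or> \<gamma> \<le> 0 \<and> a \<le> 0"
        using ga k by auto
      then have "m_sign \<gamma> a" "c_sign \<gamma> a"
        by (auto simp: m_sign_def c_sign_def mult_nonpos_nonpos)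
      moreover have "a = 0 \<or> \<bar>u\<bar> \<le> t"
        using \<open>a = - \<mu> 1\<close> k t by auto
      ultimately show ?thesis
        using bound 3 t by auto
    qed
  next
    case Steffensen_Ulbrich
    let ?s = "(u + g) / t"
    have k: "\<mu> 0 \<ge> 0" "\<mu> 1 \<ge> 0" "\<mu> 2 \<ge> 0" "g \<le> 0" "u \<ge> 0"
      "\<mu> 0 = 0 \<or> g = 0" "\<mu> 1 = 0 \<or> u = 0" "\<mu> 2 = 0 \<or> phi_SU \<theta> t g u = 0"
      using kkt[of 0] kkt[of 1] kkt[of 2] by (auto simp: I_def Steffensen_Ulbrich)
    have ga: "\<gamma> = - \<mu> 0 + \<mu> 2 * (1 + reg_slope \<theta> ?s)" "a = - \<mu> 1 + \<mu> 2 * (1 - reg_slope \<theta> ?s)"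
      by (auto simp: \<gamma>_def a_def I_def Steffensen_Ulbrich numeral_eq_Suc lessThan_Suc algebra_simps)
    consider "\<mu> 2 = 0" | "\<mu> 2 \<noteq> 0" "g + u \<le> - t" | "\<mu> 2 \<noteq> 0" "g + u \<ge> t" | "\<mu> 2 \<noteq> 0" "\<bar>u + g\<bar> < t"
      by linarith
    then show ?thesis
    proof cases
      case 1
      then show ?thesis
        using k t ga by (auto simp: c_sign_def Steffensen_Ulbrich)
    next
      case 2
      then have "reg_slope \<theta> ?s = -1"
        using t by (intro reg_extend_properties(3)[OF reg]) (simp add: field_simps)
      moreover have "u = 0"
        using 2 k by (simp add: phi_SU_def)
      moreover have "\<mu> 0 = 0"
        using 2 k t \<open>u = 0\<close> by auto
      ultimately show ?thesis
        using ga t by (auto simp: c_sign_def Steffensen_Ulbrich)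
    next
      case 3
      then have "reg_slope \<theta> ?s = 1"
        using t by (intro reg_extend_properties(2)[OF reg]) (simp add: field_simps)
      moreover have "g = 0"
        using 3 k t by (auto simp: phi_SU_def split: if_splits)
      moreover have "\<mu> 1 = 0"
        using 3 k t \<open>g = 0\<close> by auto
      ultimately show ?thesis
        using ga t by (auto simp: c_sign_def Steffensen_Ulbrich)
    next
      case 4
      \<comment> \<open>On the smooth arc \<open>u\<close> and \<open>- g\<close> lie in \<open>]0, t]\<close>, so the sign constraints are inactive there.\<close>
      then have s: "\<bar>?s\<bar> < 1"
        using t by (simp add: abs_divide)
      have "\<not> g + u \<le> - t" "\<not> t \<le> g + u"
        using 4 by auto
      then have "phi_SU \<theta> t g u = u - g - t * \<theta> ?s"
        by (simp add: phi_SU_def)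
      then have "u - g = t * \<theta> ?s"
        using 4 k(8) by simp
      moreover have "u + g = t * ?s"
        using t by simp
      ultimately have ug: "2 * u = t * (\<theta> ?s + ?s)" "- 2 * g = t * (\<theta> ?s - ?s)"
        by (simp_all only: distrib_left right_diff_distrib)
      have b: "0 < \<theta> ?s + ?s" "\<theta> ?s + ?s \<le> 2" "0 < \<theta> ?s - ?s" "\<theta> ?s - ?s \<le> 2"
        using reg_extend_properties(5,6)[OF reg s] by linarith+
      have "0 < t * (\<theta> ?s + ?s)" "0 < t * (\<theta> ?s - ?s)"
        "t * (\<theta> ?s + ?s) \<le> t * 2" "t * (\<theta> ?s - ?s) \<le> t * 2"
        using mult_pos_pos[OF t b(1)] mult_pos_pos[OF t b(3)]
          mult_left_mono[OF b(2)] mult_left_mono[OF b(4)] t by (blast intro: less_imp_le)+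
      then have "0 < u" "g < 0" "u \<le> t" "- g \<le> t"
        using ug by linarith+
      moreover have "\<bar>reg_slope \<theta> ?s\<bar> \<le> 1"
        by (rule reg_extend_properties(4)[OF reg s])
      ultimately show ?thesis
        using bound k ga by (auto simp: c_sign_def Steffensen_Ulbrich)
    qed
  next
    case Kanzow_Schwartz
    let ?m = "max 0 (u - g - 2 * t)"
    have k: "\<mu> 0 \<ge> 0" "\<mu> 1 \<ge> 0" "\<mu> 2 \<ge> 0" "g \<le> 0" "u \<ge> 0"
      "\<mu> 0 = 0 \<or> g = 0" "\<mu> 1 = 0 \<or> u = 0" "\<mu> 2 = 0 \<or> phi_KS t g u = 0"
      using kkt[of 0] kkt[of 1] kkt[of 2] by (auto simp: I_def Kanzow_Schwartz)
    have ga: "\<gamma> = - \<mu> 0 + \<mu> 2 * (?m - (- g - t))" "a = - \<mu> 1 + \<mu> 2 * (?m - (u - t))"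
      by (auto simp: \<gamma>_def a_def I_def Kanzow_Schwartz numeral_eq_Suc lessThan_Suc algebra_simps)
    show ?thesis
    proof (cases "\<mu> 2 = 0")
      case True
      then have "\<gamma> \<le> 0" "a \<le> 0" "a * u + \<gamma> * g = 0"
        using k ga by auto
      then show ?thesis
        using zero by (auto simp: m_sign_def c_sign_def mult_nonpos_nonpos)
    next
      case False
      then have ks: "phi_KS t g u = 0"
        using k by blast
      \<comment> \<open>The quadratic expression vanishes only at \<open>u = - g = t\<close>, which belongs to the product branch.\<close>
      have ge: "u - g \<ge> 2 * t"
      proof (rule ccontr)
        assume lt: "\<not> 2 * t \<le> u - g"
        then have "(u - t)\<^sup>2 + (- g - t)\<^sup>2 = 0"
          using ks by (simp add: phi_KS_def)
        then have "u = t" "- g = t"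
          by (auto simp: sum_power2_eq_zero_iff)
        then show False
          using lt by simp
      qed
      then have "(u - t) * (- g - t) = 0"
        using ks by (simp add: phi_KS_def)
      then consider "u = t" "- g \<ge> t" | "- g = t" "u \<ge> t"
        using ge by fastforce
      then show ?thesis
      proof cases
        case 1
        then have "\<gamma> = 0"
          using k ga t ge by auto
        then show ?thesis
          using bound 1 t by (auto simp: m_sign_def c_sign_def)
      next
        case 2
        then have "a = 0"
          using k ga t ge by auto
        then show ?thesis
          using bound 2 t by (auto simp: m_sign_def c_sign_def)
      qed
    qed
  qed
  then show "\<bar>a * u + \<gamma> * g\<bar> \<le> t * (\<bar>a\<bar> + \<bar>\<gamma>\<bar>)" "c_sign \<gamma> a"
    "R \<in> {Kadrani_Dussault_Benchakroun, Kanzow_Schwartz} \<Longrightarrow> m_sign \<gamma> a"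
    by auto
qed

section \<open>The Lagrangian of a convex lower-level problem\<close>

lemma has_cont_grad_partial:
  assumes "cont_diff 2 h"
  shows "has_cont_grad (\<lambda>z. nabla h z \<bullet> v)"
proof -
  have c: "cont_diff (Suc (Suc 0)) h"
    using assms by (simp add: numeral_2_eq_2)
  then have "has_cont_grad h"
    by (rule cont_diff_imp_has_cont_grad) simp
  then have "frechet_derivative h (at z) v = nabla h z \<bullet> v" for z
    using frechet_derivative_at[of h _ z] has_cont_gradD[of h z]
    by (metis gderiv_def inner_commute)
  moreover have "has_cont_grad (\<lambda>z. frechet_derivative h (at z) v)"
    using c by (intro cont_diff_one_imp_has_cont_grad) simp
  ultimately show ?thesis
    by simp
qed

lemma lagr_has_cont_grad:
  fixes f :: "(real ^ 'n) \<times> (real ^ 'm) \<Rightarrow> real" and g :: "(real ^ 'n) \<times> (real ^ 'm) \<Rightarrow> real ^ 'q"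
  assumes f: "cont_diff 2 f" and g: "cont_diff 2 g"
  shows "has_cont_grad (\<lambda>z. lagr f g z $ l)"
proof -
  let ?e = "(0, axis l 1) :: (real ^ 'n) \<times> (real ^ 'm)"
  have gi: "cont_diff 2 (\<lambda>p. g p $ i)" for i
    using g by (rule cont_diff_component)
  have C1: "has_cont_grad h" if "cont_diff 2 h" for h :: "(real ^ 'n) \<times> (real ^ 'm) \<Rightarrow> real"
    using that by (rule cont_diff_imp_has_cont_grad) simp
  have sec: "nabla (\<lambda>y'. h (x, y')) y $ l = nabla h (x, y) \<bullet> ?e"
    if "cont_diff 2 h" for h :: "(real ^ 'n) \<times> (real ^ 'm) \<Rightarrow> real" and x y
    using nabla_snd[OF C1[OF that], of x y] by (simp add: inner_prod_def inner_axis)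
  have "(\<lambda>z. lagr f g z $ l) = (\<lambda>z. (case z of (x, y, u) \<Rightarrow> nabla f (x, y) \<bullet> ?e)
      + (\<Sum>i\<in>UNIV. (z \<bullet> (0, 0, axis i 1))
           * (case z of (x, y, u) \<Rightarrow> nabla (\<lambda>p. g p $ i) (x, y) \<bullet> ?e)))"
    using sec[OF f] sec[OF gi] by (auto simp: fun_eq_iff lagr_def inner_prod_def inner_axis)
  then show ?thesis
    using has_cont_grad_partial[OF f] has_cont_grad_partial[OF gi]
    by (auto intro!: has_cont_grad_add has_cont_grad_sum has_cont_grad_mult has_cont_grad_inner
        has_cont_grad_forget)
qed

lemma jacT_scaleR: "jacT h z (c *\<^sub>R w) = c *\<^sub>R jacT h z w"
  by (simp add: jacT_def scaleR_sum_right)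

lemma inner_jacT: "jacT h z w \<bullet> v = (\<Sum>l\<in>UNIV. w $ l * (nabla (\<lambda>z'. h z' $ l) z \<bullet> v))"
  by (simp add: jacT_def inner_sum_left)

lemma has_cont_grad_component:
  assumes "cont_diff k h" and "0 < k"
  shows "has_cont_grad (\<lambda>z. h z $ i)"
  using assms by (intro cont_diff_imp_has_cont_grad cont_diff_component)

lemma jacT_fst_tendsto:
  fixes h :: "'a::euclidean_space \<times> 'b::euclidean_space \<Rightarrow> real ^ 'k"
  assumes "\<And>l. has_cont_grad (\<lambda>z. h z $ l)"
    and "(X \<longlongrightarrow> x) A" "(Y \<longlongrightarrow> y) A" "(W \<longlongrightarrow> w) A"
  shows "((\<lambda>k. jacT (\<lambda>x'. h (x', Y k)) (X k) (W k)) \<longlongrightarrow> jacT (\<lambda>x'. h (x', y)) x w) A"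
  unfolding jacT_def nabla_fst[OF assms(1)]
  by (intro tendsto_intros has_cont_grad_tendsto assms)

lemma jacT_snd_tendsto:
  fixes h :: "'a::euclidean_space \<times> 'b::euclidean_space \<Rightarrow> real ^ 'k"
  assumes "\<And>l. has_cont_grad (\<lambda>z. h z $ l)"
    and "(X \<longlongrightarrow> x) A" "(Y \<longlongrightarrow> y) A" "(W \<longlongrightarrow> w) A"
  shows "((\<lambda>k. jacT (\<lambda>y'. h (X k, y')) (Y k) (W k)) \<longlongrightarrow> jacT (\<lambda>y'. h (x, y')) y w) A"
  unfolding jacT_def nabla_snd[OF assms(1)]
  by (intro tendsto_intros has_cont_grad_tendsto assms)

lemma jacT_mid_tendsto:
  fixes h :: "'a::euclidean_space \<times> 'b::euclidean_space \<times> 'c::euclidean_space \<Rightarrow> real ^ 'k"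
  assumes "\<And>l. has_cont_grad (\<lambda>z. h z $ l)"
    and "(X \<longlongrightarrow> x) A" "(Y \<longlongrightarrow> y) A" "(U \<longlongrightarrow> u) A" "(W \<longlongrightarrow> w) A"
  shows "((\<lambda>k. jacT (\<lambda>y'. h (X k, y', U k)) (Y k) (W k)) \<longlongrightarrow> jacT (\<lambda>y'. h (x, y', u)) y w) A"
  unfolding jacT_def nabla_snd_fst[OF assms(1)]
  by (intro tendsto_intros has_cont_grad_tendsto assms)

text \<open>The tangent inequality at \<open>0\<close> and at \<open>s\<close> shows that the difference quotients of \<open>D\<close> at \<open>0\<close> are nonnegative.\<close>

lemma convex_on_line_curvature_nonneg:
  fixes \<psi> D :: "real \<Rightarrow> real"
  assumes conv: "convex_on UNIV \<psi>" and D: "\<And>s. DERIV \<psi> s :> D s" and c: "DERIV D 0 :> c"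
  shows "c \<ge> 0"
proof -
  have tangent: "D r * (s - r) \<le> \<psi> s - \<psi> r" for r s
    by (rule convex_on_imp_above_tangent[OF conv]) (use D in auto)
  have "0 \<le> (D s - D 0) / (s - 0)" for s
  proof -
    have "0 \<le> (D s - D 0) * s"
      using tangent[of 0 s] tangent[of s 0] by (simp add: algebra_simps)
    then show ?thesis
      by (simp add: zero_le_divide_iff zero_le_mult_iff)
  qed
  moreover have "((\<lambda>s. (D s - D 0) / (s - 0)) \<longlongrightarrow> c) (at 0)"
    using c by (simp add: has_field_derivative_iff)
  ultimately show ?thesis
    by (intro tendsto_lowerbound[of _ c "at 0"]) auto
qed

lemma DERIV_along_line:
  assumes "GDERIV h (y + s *\<^sub>R v) :> d"
  shows "DERIV (\<lambda>s. h (y + s *\<^sub>R v)) s :> d \<bullet> v"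
proof -
  have "((\<lambda>s. h (y + s *\<^sub>R v)) has_derivative (\<lambda>r. (r *\<^sub>R v) \<bullet> d)) (at s)"
    using assms unfolding gderiv_def
    by (rule has_derivative_compose[rotated]) (auto intro!: derivative_eq_intros)
  then show ?thesis
    by (simp add: has_field_derivative_def inner_commute mult_commute_abs)
qed

text \<open>\<open>\<L>(x, \<cdot>, u)\<close> is the gradient of the function \<open>f(x, \<cdot>) + \<Sum>\<^sub>i u\<^sub>i g\<^sub>i(x, \<cdot>)\<close>, which is convex as
\<open>u \<ge> 0\<close>. The quadratic form of its Hessian in direction \<open>\<beta>\<close> is the second derivative along a line.\<close>

lemma lagr_jacobian_psd:
  fixes f :: "(real ^ 'n) \<times> (real ^ 'm) \<Rightarrow> real" and g :: "(real ^ 'n) \<times> (real ^ 'm) \<Rightarrow> real ^ 'q"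
  assumes f: "cont_diff 2 f" and g: "cont_diff 2 g"
    and conv: "convex_on UNIV (\<lambda>y. f (x, y))" "\<And>i. convex_on UNIV (\<lambda>y. g (x, y) $ i)"
    and u: "0 \<le> u"
  shows "jacT (\<lambda>y'. lagr f g (x, y', u)) y \<beta> \<bullet> \<beta> \<ge> 0"
proof -
  let ?h = "\<lambda>y'. f (x, y') + (\<Sum>i\<in>UNIV. u $ i * g (x, y') $ i)"
  let ?l = "\<lambda>s. y + s *\<^sub>R \<beta>"
  have C1: "has_cont_grad f" "\<And>i. has_cont_grad (\<lambda>p. g p $ i)"
    using cont_diff_imp_has_cont_grad[OF f] has_cont_grad_component[OF g] by auto
  have grad: "GDERIV ?h y' :> lagr f g (x, y', u)" for y'
  proof -
    have "GDERIV (\<lambda>y'. f (x, y')) y' :> nabla (\<lambda>y'. f (x, y')) y'"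
      "GDERIV (\<lambda>y'. g (x, y') $ i) y' :> nabla (\<lambda>y'. g (x, y') $ i) y'" for i
      using gderiv_section_snd[OF has_cont_gradD[OF C1(1), where z="(x, y')"]]
        gderiv_section_snd[OF has_cont_gradD[OF C1(2), where z="(x, y')"]] nabla_eqI by metis+
    then show ?thesis
      unfolding gderiv_def lagr_def
      by (auto intro!: derivative_eq_intros simp: inner_add_right inner_sum_right)
  qed
  have line: "convex_on UNIV (\<lambda>s. k (?l s))" if "convex_on UNIV k" for k :: "real ^ 'm \<Rightarrow> real"
    unfolding convex_on_def
  proof (safe)
    fix r s a b :: real
    assume ab: "0 \<le> a" "0 \<le> b" "a + b = 1"
    have "a *\<^sub>R y + b *\<^sub>R y = y"
      using ab(3) by (metis scaleR_add_left scaleR_one)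
    then have "a *\<^sub>R ?l r + b *\<^sub>R ?l s = ?l (a *\<^sub>R r + b *\<^sub>R s)"
      by (simp add: algebra_simps)
    then show "k (?l (a *\<^sub>R r + b *\<^sub>R s)) \<le> a * k (?l r) + b * k (?l s)"
      using that ab by (metis UNIV_I convex_on_def)
  qed simp
  have "convex_on UNIV (\<lambda>s. \<Sum>i\<in>I. u $ i * g (x, ?l s) $ i)" if "finite I" for I
    using that
  proof (induction rule: finite_induct)
    case (insert i I)
    then show ?case
      using u convex_on_cmul[OF _ line[OF conv(2)], of "u $ i" i]
      by (auto simp: less_eq_vec_def intro!: convex_on_add)
  qed (simp add: convex_on_const)
  then have "convex_on UNIV (\<lambda>s. ?h (?l s))"
    using line[OF conv(1)] by (intro convex_on_add) auto
  moreover have "DERIV (\<lambda>s. ?h (?l s)) s :> lagr f g (x, ?l s, u) \<bullet> \<beta>" for s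
    using grad by (rule DERIV_along_line)
  moreover have "DERIV (\<lambda>s. lagr f g (x, ?l s, u) \<bullet> \<beta>) 0 :> jacT (\<lambda>y'. lagr f g (x, y', u)) y \<beta> \<bullet> \<beta>"
  proof -
    have "DERIV (\<lambda>s. lagr f g (x, ?l s, u) $ l) 0 :> nabla (\<lambda>y'. lagr f g (x, y', u) $ l) y \<bullet> \<beta>" for l
      unfolding nabla_snd_fst[OF lagr_has_cont_grad[OF f g]]
      using gderiv_section_fst[OF gderiv_section_snd[OF has_cont_gradD[OF lagr_has_cont_grad[OF f g]]]]
      by (intro DERIV_along_line) simp
    moreover have "(\<lambda>s. lagr f g (x, ?l s, u) \<bullet> \<beta>) = (\<lambda>s. \<Sum>l\<in>UNIV. \<beta> $ l * lagr f g (x, ?l s, u) $ l)"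
      by (simp add: inner_vec_def mult.commute)
    ultimately show ?thesis
      unfolding inner_jacT by (simp only:) (intro DERIV_sum DERIV_cmult)
  qed
  ultimately show ?thesis
    by (rule convex_on_line_curvature_nonneg)
qed

section \<open>Limits of multipliers\<close>

text \<open>The dichotomy behind every multiplier bound: either some subsequence converges, or suitably scaled
terms of a subsequence converge to a unit vector while the scaling factors tend to \<open>0\<close>, so that
whatever is bounded disappears from a scaled linear equation. The indices \<open>r\<close> need only tend to
infinity, which spares the construction of a monotone selection.\<close>

lemma convergent_or_unbounded_direction:
  fixes v :: "nat \<Rightarrow> 'a::euclidean_space"
  obtains (convergent) r l where "filterlim r sequentially sequentially" "(\<lambda>k. v (r k)) \<longlonglongrightarrow> l"
  | (unbounded) r c d where "filterlim r sequentially sequentially" "\<And>k. 0 \<le> c k" "c \<longlonglongrightarrow> 0"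
      "(\<lambda>k. c k *\<^sub>R v (r k)) \<longlonglongrightarrow> d" "norm d = 1"
proof (cases "bounded (range v)")
  case True
  then obtain l r where "strict_mono r" "(v \<circ> r) \<longlonglongrightarrow> l"
    using bounded_imp_convergent_subsequence by blast
  then show ?thesis
    using convergent[of r l] filterlim_subseq by (auto simp: o_def)
next
  case False
  \<comment> \<open>The summand \<open>1\<close> keeps the norms positive, so that they can be inverted.\<close>
  have "\<exists>n\<ge>k. norm (v n) \<ge> real k + 1" for k
  proof (rule ccontr)
    assume "\<not> ?thesis"
    then have "v n \<in> v ` {..<k} \<union> ball 0 (real k + 1)" for n
      by (cases "n < k") (auto simp: not_le)
    then have "range v \<subseteq> v ` {..<k} \<union> ball 0 (real k + 1)"
      by blast
    then have "bounded (range v)"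
      by (rule bounded_subset[rotated]) (simp add: finite_imp_bounded)
    then show False
      using False by contradiction
  qed
  then obtain r where r: "\<And>k. r k \<ge> k" "\<And>k. norm (v (r k)) \<ge> real k + 1"
    by metis
  let ?c = "\<lambda>k. inverse (norm (v (r k)))"
  have "v (r k) \<noteq> 0" for k
    using r(2)[of k] by (metis norm_zero not_less of_nat_0_le_iff add_nonneg_pos zero_less_one)
  then have "?c k *\<^sub>R v (r k) \<in> sphere 0 1" for k
    by simp
  then obtain d s where s: "d \<in> sphere 0 1" "strict_mono s" "((\<lambda>k. ?c k *\<^sub>R v (r k)) \<circ> s) \<longlonglongrightarrow> d"
    using seq_compactE[OF compact_imp_seq_compact[OF compact_sphere[of "0::'a" 1]],
        of "\<lambda>k. ?c k *\<^sub>R v (r k)"] by blast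
  have rlim: "filterlim r sequentially sequentially"
    using r(1) by (intro filterlim_at_top_mono[OF filterlim_ident]) auto
  have slim: "filterlim s sequentially sequentially"
    using s(2) by (rule filterlim_subseq)
  have clim: "?c \<longlonglongrightarrow> 0"
  proof (rule tendsto_sandwich[of "\<lambda>k. 0"])
    show "\<forall>\<^sub>F k in sequentially. ?c k \<le> inverse (real k + 1)"
    proof (intro always_eventually allI le_imp_inverse_le)
      show "real k + 1 \<le> norm (v (r k))" for k
        by (rule r(2))
    qed simp
    show "(\<lambda>k. inverse (real k + 1)) \<longlonglongrightarrow> 0"
      using LIMSEQ_inverse_real_of_nat by (simp add: add.commute)
  qed simp_all
  show ?thesis
  proof (rule unbounded)
    show "filterlim (\<lambda>k. r (s k)) sequentially sequentially"
      using rlim slim by (rule filterlim_compose)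
    show "(\<lambda>k. ?c (s k)) \<longlonglongrightarrow> 0"
      using clim slim by (rule filterlim_compose)
    show "(\<lambda>k. ?c (s k) *\<^sub>R v (r (s k))) \<longlonglongrightarrow> d"
      using s(3) by (simp only: o_def)
  qed (use s(1) in simp_all)
qed

text \<open>The nearest points of \<open>S\<close> to \<open>a\<^sub>k\<close> are at distance at most the excess, and they cluster in \<open>S\<close>.\<close>

lemma convergent_subsequence_of_excess_zero:
  fixes S :: "'a::euclidean_space set"
  assumes S: "compact S" "S \<noteq> {}" and a: "\<And>k. a k \<in> A k"
    and lim: "(\<lambda>k. excess (A k) S) \<longlonglongrightarrow> 0"
  obtains r b where "filterlim r sequentially sequentially" "b \<in> S" "(\<lambda>k. a (r k)) \<longlonglongrightarrow> b"
proof -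
  have "\<exists>b\<in>S. \<forall>b'\<in>S. norm (a k - b) \<le> norm (a k - b')" for k
    using S by (intro continuous_attains_inf continuous_intros)
  then obtain b where b: "\<And>k. b k \<in> S" "\<And>k b'. b' \<in> S \<Longrightarrow> norm (a k - b k) \<le> norm (a k - b')"
    by metis
  have le: "ennreal (norm (a k - b k)) \<le> excess (A k) S" for k
  proof -
    have "ennreal (norm (a k - b k)) \<le> (INF b\<in>S. ennreal (norm (a k - b)))"
      using b(2) by (intro INF_greatest ennreal_leI)
    also have "\<dots> \<le> excess (A k) S"
      unfolding excess_def using a by (intro SUP_upper)
    finally show ?thesis .
  qed
  have "(\<lambda>k. ennreal (norm (a k - b k))) \<longlonglongrightarrow> ennreal 0"
    unfolding ennreal_0 by (rule tendsto_sandwich[OF _ _ tendsto_const lim]) (simp_all add: le)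
  then have "(\<lambda>k. norm (a k - b k)) \<longlonglongrightarrow> 0"
    by (subst (asm) tendsto_ennreal_iff) auto
  then have diff: "(\<lambda>k. a k - b k) \<longlonglongrightarrow> 0"
    by (rule tendsto_norm_zero_cancel)
  obtain l r where r: "l \<in> S" "strict_mono r" "(b \<circ> r) \<longlonglongrightarrow> l"
    using seq_compactE[OF compact_imp_seq_compact[OF S(1)], of b] b(1) by blast
  have "(\<lambda>k. (a (r k) - b (r k)) + b (r k)) \<longlonglongrightarrow> 0 + l"
    using r(3) filterlim_compose[OF diff filterlim_subseq[OF r(2)]]
    by (intro tendsto_add) (auto simp: o_def)
  then show ?thesis
    using that[of r l] r filterlim_subseq by auto
qed

text \<open>In this form the M-type condition is an intersection of two closed cones, hence stable under limits
and nonnegative scaling.\<close>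

lemma m_sign_iff: "m_sign \<gamma> a \<longleftrightarrow> c_sign \<gamma> a \<and> min \<gamma> a \<le> 0"
  unfolding m_sign_def c_sign_def by (auto simp: zero_le_mult_iff mult_nonpos_nonpos min_le_iff_disj)

lemma sign_tendsto:
  assumes "\<sigma> \<in> {c_sign, m_sign}" and "\<And>k. \<sigma> (\<gamma>' k) (a' k)"
    and lim: "\<gamma>' \<longlonglongrightarrow> \<gamma>" "a' \<longlonglongrightarrow> a"
  shows "\<sigma> \<gamma> a"
proof -
  have "c_sign \<gamma> a" if "\<And>k. c_sign (\<gamma>' k) (a' k)"
    using that tendsto_lowerbound[OF tendsto_mult[OF lim], of 0] by (auto simp: c_sign_def)
  moreover have "min \<gamma> a \<le> 0" if "\<And>k. min (\<gamma>' k) (a' k) \<le> 0"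
    using that tendsto_upperbound[OF tendsto_min[OF lim], of 0] by auto
  ultimately show ?thesis
    using assms(1,2) by (auto simp: m_sign_iff)
qed

lemma sign_scale:
  assumes "\<sigma> \<in> {c_sign, m_sign}" and "\<sigma> \<gamma> a" and "0 \<le> c"
  shows "\<sigma> (c * \<gamma>) (c * a)"
proof -
  have "c_sign (c * \<gamma>) (c * a)" if "c_sign \<gamma> a"
    using mult_nonneg_nonneg[of "c * c" "\<gamma> * a"] that
    by (simp add: c_sign_def mult.assoc mult.left_commute)
  moreover have "min (c * \<gamma>) (c * a) \<le> 0" if "min \<gamma> a \<le> 0"
    using that mult_nonneg_nonpos[OF \<open>0 \<le> c\<close>] unfolding min_le_iff_disj by blast
  ultimately show ?thesis
    using assms(1,2) by (auto simp only: m_sign_iff insert_iff empty_iff)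
qed

text \<open>What the multipliers of every relaxation satisfy at level \<open>t\<close>: an approximate version of
\<^const>\<open>sign_system\<close> that, unlike the latter, does not refer to index sets, which may change along a
sequence.\<close>

definition relaxed_signs ::
    "(real \<Rightarrow> real \<Rightarrow> bool) \<Rightarrow> ((real ^ 'n) \<times> (real ^ 'm) \<Rightarrow> real ^ 'q) \<Rightarrow> real \<Rightarrow>
     (real ^ 'n) \<times> (real ^ 'm) \<times> (real ^ 'q) \<Rightarrow> real ^ 'm \<Rightarrow> real ^ 'q \<Rightarrow> bool" where
  "relaxed_signs \<sigma> g t = (\<lambda>(x, y, u) \<beta> \<gamma>. \<forall>i.
     let a = nabla (\<lambda>y'. g (x, y') $ i) y \<bullet> \<beta>
     in \<bar>a * u $ i + \<gamma> $ i * g (x, y) $ i\<bar> \<le> t * (\<bar>a\<bar> + \<bar>\<gamma> $ i\<bar>) \<and> \<sigma> (\<gamma> $ i) a)"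

lemma relaxed_signs_scale:
  assumes "\<sigma> \<in> {c_sign, m_sign}" and "relaxed_signs \<sigma> g t (x, y, u) \<beta> \<gamma>" and c: "0 \<le> c"
  shows "relaxed_signs \<sigma> g t (x, y, u) (c *\<^sub>R \<beta>) (c *\<^sub>R \<gamma>)"
  unfolding relaxed_signs_def Let_def case_prod_conv
proof (intro allI conjI)
  fix i
  let ?a = "nabla (\<lambda>y'. g (x, y') $ i) y \<bullet> \<beta>"
  have i: "\<bar>?a * u $ i + \<gamma> $ i * g (x, y) $ i\<bar> \<le> t * (\<bar>?a\<bar> + \<bar>\<gamma> $ i\<bar>)" "\<sigma> (\<gamma> $ i) ?a"
    using assms(2) by (auto simp: relaxed_signs_def Let_def)
  have "\<bar>(c * ?a) * u $ i + (c * \<gamma> $ i) * g (x, y) $ i\<bar> = \<bar>c * (?a * u $ i + \<gamma> $ i * g (x, y) $ i)\<bar>"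
    by (simp add: algebra_simps)
  also have "\<dots> = c * \<bar>?a * u $ i + \<gamma> $ i * g (x, y) $ i\<bar>"
    by (simp only: abs_mult abs_of_nonneg[OF c])
  also have "\<dots> \<le> c * (t * (\<bar>?a\<bar> + \<bar>\<gamma> $ i\<bar>))"
    using i(1) c by (rule mult_left_mono)
  also have "\<dots> = t * (\<bar>c * ?a\<bar> + \<bar>c * \<gamma> $ i\<bar>)"
    by (simp only: abs_mult abs_of_nonneg[OF c]) (simp add: algebra_simps)
  finally show "\<bar>(nabla (\<lambda>y'. g (x, y') $ i) y \<bullet> c *\<^sub>R \<beta>) * u $ i + (c *\<^sub>R \<gamma>) $ i * g (x, y) $ i\<bar>
      \<le> t * (\<bar>nabla (\<lambda>y'. g (x, y') $ i) y \<bullet> c *\<^sub>R \<beta>\<bar> + \<bar>(c *\<^sub>R \<gamma>) $ i\<bar>)"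
    by (simp only: inner_scaleR_right vector_scaleR_component real_scaleR_def)
  show "\<sigma> ((c *\<^sub>R \<gamma>) $ i) (nabla (\<lambda>y'. g (x, y') $ i) y \<bullet> c *\<^sub>R \<beta>)"
    using sign_scale[OF assms(1) i(2) c] by simp
qed

lemma relaxed_signs_tendsto:
  fixes g :: "(real ^ 'n) \<times> (real ^ 'm) \<Rightarrow> real ^ 'q"
  assumes \<sigma>: "\<sigma> \<in> {c_sign, m_sign}" and g: "\<And>i. has_cont_grad (\<lambda>p. g p $ i)"
    and T: "T \<longlonglongrightarrow> 0" and X: "X \<longlonglongrightarrow> x" and Y: "Y \<longlonglongrightarrow> y" and U: "U \<longlonglongrightarrow> u"
    and B: "B \<longlonglongrightarrow> \<beta>" and \<Gamma>: "\<Gamma> \<longlonglongrightarrow> \<gamma>"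
    and signs: "\<And>k. relaxed_signs \<sigma> g (T k) (X k, Y k, U k) (B k) (\<Gamma> k)"
  shows "sign_system \<sigma> g (x, y, u) \<beta> \<gamma>"
proof -
  let ?a = "\<lambda>i. nabla (\<lambda>y'. g (x, y') $ i) y \<bullet> \<beta>"
  let ?A = "\<lambda>i k. nabla (\<lambda>y'. g (X k, y') $ i) (Y k) \<bullet> B k"
  have A: "?A i \<longlonglongrightarrow> ?a i" for i
    unfolding nabla_snd[OF g] by (intro tendsto_intros has_cont_grad_tendsto g X Y B)
  have gi: "(\<lambda>k. g (X k, Y k) $ i) \<longlonglongrightarrow> g (x, y) $ i" for i
    using continuous_on_tendsto_compose[OF has_cont_grad_cont[OF g] tendsto_Pair[OF X Y]] by simp
  have k: "\<bar>?A i k * U k $ i + \<Gamma> k $ i * g (X k, Y k) $ i\<bar> \<le> T k * (\<bar>?A i k\<bar> + \<bar>\<Gamma> k $ i\<bar>)"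
    "\<sigma> (\<Gamma> k $ i) (?A i k)" for k i
    using signs[of k] by (auto simp: relaxed_signs_def Let_def)
  have sign: "\<sigma> (\<gamma> $ i) (?a i)" for i
    using k(2) tendsto_vec_nth[OF \<Gamma>] A by (rule sign_tendsto[OF \<sigma>])
  have "\<bar>?a i * u $ i + \<gamma> $ i * g (x, y) $ i\<bar> \<le> 0 * (\<bar>?a i\<bar> + \<bar>\<gamma> $ i\<bar>)" for i
  proof (rule LIMSEQ_le)
    show "(\<lambda>k. \<bar>?A i k * U k $ i + \<Gamma> k $ i * g (X k, Y k) $ i\<bar>)
        \<longlonglongrightarrow> \<bar>?a i * u $ i + \<gamma> $ i * g (x, y) $ i\<bar>"
      by (intro tendsto_intros A U \<Gamma> gi)
    show "(\<lambda>k. T k * (\<bar>?A i k\<bar> + \<bar>\<Gamma> k $ i\<bar>)) \<longlonglongrightarrow> 0 * (\<bar>?a i\<bar> + \<bar>\<gamma> $ i\<bar>)"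
      by (intro tendsto_intros T A \<Gamma>)
  qed (use k(1) in blast)
  then have compl: "?a i * u $ i + \<gamma> $ i * g (x, y) $ i = 0" for i
    by simp
  show ?thesis
    unfolding sign_system_def case_prod_conv
  proof (intro conjI ballI)
    fix i assume "i \<in> idx_nu g (x, y, u)"
    then show "?a i = 0"
      using compl[of i] by (simp add: idx_nu_def)
  next
    fix i assume "i \<in> idx_eta g (x, y, u)"
    then show "\<gamma> $ i = 0"
      using compl[of i] by (simp add: idx_eta_def)
  qed (rule sign)
qed

text \<open>Convexity closes the gap between the two types of sign conditions: in the identity
\<open>\<beta>\<^sup>T (\<nabla>\<^sub>y \<L>) \<beta> + \<Sum>\<^sub>i \<gamma>\<^sub>i a\<^sub>i = 0\<close> all terms are nonnegative, so each \<open>\<gamma>\<^sub>i a\<^sub>i\<close> vanishes. A solution with the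
C-type signs therefore belongs to both sets \<open>\<Lambda>\<^sup>e\<^sub>y\<close>, and \<open>A\<^sub>2\<close> followed by \<open>A\<^sub>1\<close> of either type
applies to it.\<close>

lemma homogeneous_multipliers_vanish:
  fixes f :: "(real ^ 'n) \<times> (real ^ 'm) \<Rightarrow> real" and g :: "(real ^ 'n) \<times> (real ^ 'm) \<Rightarrow> real ^ 'q"
  assumes f: "cont_diff 2 f" and g: "cont_diff 2 g"
    and conv: "convex_on UNIV (\<lambda>y. f (x, y))" "\<And>i. convex_on UNIV (\<lambda>y. g (x, y) $ i)"
    and kkt: "(y, u) \<in> kkt_set f g x"
    and signs: "sign_system c_sign g (x, y, u) \<beta> \<gamma>"
    and eq: "jacT (\<lambda>y'. lagr f g (x, y', u)) y \<beta> + jacT (\<lambda>y'. g (x, y')) y \<gamma> = 0"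
    and \<tau>: "\<tau> \<in> {c_sign, m_sign}"
    and A1: "cond_A1 \<tau> f g (x, y, u)" and A2: "cond_A2 \<tau> f g (x, y, u)"
  shows "\<beta> = 0" and "\<gamma> = 0"
proof -
  let ?a = "\<lambda>i. nabla (\<lambda>y'. g (x, y') $ i) y \<bullet> \<beta>"
  have feas: "0 \<le> u" "g (x, y) $ i \<le> 0" "0 \<le> u $ i" for i
    using kkt by (auto simp: kkt_set_def less_eq_vec_def)
  have "u $ i * g (x, y) $ i = 0" for i
  proof -
    have "(\<Sum>i\<in>UNIV. - (u $ i * g (x, y) $ i)) = 0"
      using kkt by (simp add: kkt_set_def inner_vec_def sum_negf)
    then show ?thesis
      using feas by (subst (asm) sum_nonneg_eq_0_iff) (auto simp: mult_nonneg_nonpos)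
  qed
  then have nonneg: "\<gamma> $ i * ?a i \<ge> 0" for i
    using signs feas(2,3)[of i]
    by (cases "u $ i = 0"; cases "g (x, y) $ i = 0")
       (auto simp: sign_system_def idx_nu_def idx_eta_def idx_theta_def c_sign_def)
  have "jacT (\<lambda>y'. lagr f g (x, y', u)) y \<beta> \<bullet> \<beta> + (\<Sum>i\<in>UNIV. \<gamma> $ i * ?a i) = 0"
    using arg_cong[OF eq, of "\<lambda>v. v \<bullet> \<beta>"] by (simp add: inner_add_left inner_jacT)
  moreover have "jacT (\<lambda>y'. lagr f g (x, y', u)) y \<beta> \<bullet> \<beta> \<ge> 0"
    using f g conv feas(1) by (rule lagr_jacobian_psd)
  ultimately have "(\<Sum>i\<in>UNIV. \<gamma> $ i * ?a i) = 0"
    using nonneg by (smt (verit) sum_nonneg)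
  then have zero: "\<gamma> $ i * ?a i = 0" for i
    using nonneg by (subst (asm) sum_nonneg_eq_0_iff) auto
  have "\<tau> (\<gamma> $ i) (?a i)" for i
    using \<tau> zero[of i] by (auto simp: c_sign_def m_sign_def)
  then have signs': "sign_system \<tau> g (x, y, u) \<beta> \<gamma>"
    using signs by (auto simp: sign_system_def)
  have full: "jacT (\<lambda>(x', y'). lagr f g (x', y', u)) (x, y) \<beta> + jacT g (x, y) \<gamma> =
      (jacT (\<lambda>x'. lagr f g (x', y, u)) x \<beta> + jacT (\<lambda>x'. g (x', y)) x \<gamma>,
       jacT (\<lambda>y'. lagr f g (x, y', u)) y \<beta> + jacT (\<lambda>y'. g (x, y')) y \<gamma>)"
  proof -
    note L = lagr_has_cont_grad[OF f g] and G = has_cont_grad_component[OF g, simplified]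
    have "nabla (\<lambda>z'. (case z' of (x', y') \<Rightarrow> lagr f g (x', y', u)) $ l) (x, y) =
        (nabla (\<lambda>x'. lagr f g (x', y, u) $ l) x, nabla (\<lambda>y'. lagr f g (x, y', u) $ l) y)" for l
      using nabla_fst_snd_fst[OF L] nabla_fst[OF L] nabla_snd_fst[OF L] by (simp add: case_prod_beta')
    moreover have "nabla (\<lambda>z'. g z' $ i) (x, y) =
        (nabla (\<lambda>x'. g (x', y) $ i) x, nabla (\<lambda>y'. g (x, y') $ i) y)" for i
      using nabla_fst[OF G] nabla_snd[OF G] by simp
    ultimately show ?thesis
      by (simp add: jacT_def prod_eq_iff fst_sum snd_sum)
  qed
  have "(\<beta>, \<gamma>) \<in> Lambda_e_y \<tau> f g (x, y, u)"
    using signs' eq by (simp add: Lambda_e_y_def)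
  then have "jacT (\<lambda>x'. lagr f g (x', y, u)) x \<beta> + jacT (\<lambda>x'. g (x', y)) x \<gamma> = 0"
    using A2 by (simp add: cond_A2_def)
  then have "(\<beta>, \<gamma>) \<in> Lambda_e \<tau> f g (x, y, u)"
    using signs' eq full by (simp add: Lambda_e_def zero_prod_def)
  then show "\<beta> = 0" "\<gamma> = 0"
    using A1 by (auto simp: cond_A1_def)
qed

section \<open>From stationary points of the relaxed problems to the limit\<close>

lemma phi_eq:
  "phi R \<theta> g t i j (x, y, u) = (phi_list R \<theta> t ! j) (g (x, y) $ i) (u $ i)"
  by (simp add: phi_def)

lemma nabla_phi_constraint:
  fixes h :: "'a::euclidean_space \<Rightarrow> real"
  assumes reg: "regularization_function \<theta>" and t: "t > 0" and j: "j < length (phi_list R \<theta> t)"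
    and h: "GDERIV h z :> d"
  shows "nabla (\<lambda>z'. (phi_list R \<theta> t ! j) (h z') w) z = fst ((phi_grad_list R \<theta> t ! j) (h z) w) *\<^sub>R d"
proof (rule nabla_eqI)
  have "DERIV (\<lambda>a. (phi_list R \<theta> t ! j) a w) (h z) :> fst ((phi_grad_list R \<theta> t ! j) (h z) w)"
    using gderiv_section_fst[OF phi_list_gderiv[OF reg t j, of "h z" w]] by simp
  then show "GDERIV (\<lambda>z'. (phi_list R \<theta> t ! j) (h z') w) z :> fst ((phi_grad_list R \<theta> t ! j) (h z) w) *\<^sub>R d"
    by (rule GDERIV_DERIV_compose[OF h])
qed

lemma nabla_phi_multiplier:
  fixes u :: "real ^ 'q"
  assumes reg: "regularization_function \<theta>" and t: "t > 0" and j: "j < length (phi_list R \<theta> t)"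
  shows "nabla (\<lambda>u'. (phi_list R \<theta> t ! j) c (u' $ i)) u $ i = snd ((phi_grad_list R \<theta> t ! j) c (u $ i))"
proof -
  have "DERIV (\<lambda>b. (phi_list R \<theta> t ! j) c b) (u $ i) :> snd ((phi_grad_list R \<theta> t ! j) c (u $ i))"
    using gderiv_section_snd[OF phi_list_gderiv[OF reg t j, of c "u $ i"]] by simp
  moreover have "GDERIV (\<lambda>u'. u' $ i) u :> axis i 1"
    using bounded_linear_imp_has_derivative[OF bounded_linear_vec_nth[of i], of "at u"]
    by (simp add: gderiv_def inner_axis)
  ultimately have "GDERIV (\<lambda>u'. (phi_list R \<theta> t ! j) c (u' $ i)) u :>
      snd ((phi_grad_list R \<theta> t ! j) c (u $ i)) *\<^sub>R axis i 1"
    by (rule GDERIV_DERIV_compose[rotated])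
  then show ?thesis
    by (simp add: nabla_eqI axis_def)
qed

lemma jacT_uminus: "jacT h z (- w) = - jacT h z w"
  by (simp add: jacT_def sum_negf)

text \<open>By the chain rule the relaxed constraints enter the stationarity system only through
\<open>\<nabla>g\<^sub>i\<close> and the partial derivatives of the relaxation function. Collecting coefficients turns the
system into that of the bilevel problem with \<open>\<gamma>\<^sub>i\<close> as new multipliers. The multiplier \<open>\<beta>\<close>
changes its sign because the bilevel system adds the terms that the relaxed one subtracts.\<close>

lemma relaxed_stationaryE:
  fixes F f :: "(real ^ 'n) \<times> (real ^ 'm) \<Rightarrow> real"
    and G :: "real ^ 'n \<Rightarrow> real ^ 'p"
    and g :: "(real ^ 'n) \<times> (real ^ 'm) \<Rightarrow> real ^ 'q"
  assumes reg: "regularization_function \<theta>" and t: "t > 0"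
    and g: "\<And>i. has_cont_grad (\<lambda>p. g p $ i)"
    and stat: "relaxed_stationary R \<theta> F G f g t x"
  obtains y u \<alpha> \<beta> \<gamma> where
    "(y, u) \<in> S_relaxed R \<theta> F f g t x"
    "nabla (\<lambda>x'. F (x', y)) x + jacT G x \<alpha>
       + (jacT (\<lambda>x'. lagr f g (x', y, u)) x \<beta> + jacT (\<lambda>x'. g (x', y)) x \<gamma>) = 0"
    "nabla (\<lambda>y'. F (x, y')) y
       + (jacT (\<lambda>y'. lagr f g (x, y', u)) y \<beta> + jacT (\<lambda>y'. g (x, y')) y \<gamma>) = 0"
    "\<alpha> \<ge> 0" "G x \<le> 0" "\<alpha> \<bullet> G x = 0"
    "relaxed_signs c_sign g t (x, y, u) \<beta> \<gamma>"
    "R \<in> {Kadrani_Dussault_Benchakroun, Kanzow_Schwartz} \<Longrightarrow> relaxed_signs m_sign g t (x, y, u) \<beta> \<gamma>"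
proof -
  let ?J = "phi_idx R \<theta> t"
  obtain y u \<alpha> \<beta> and mult :: "'q \<Rightarrow> nat \<Rightarrow> real" where
    sol: "(x, y, u) \<in> gph (S_relaxed R \<theta> F f g t)" and
    ex: "nabla (\<lambda>x'. F (x', y)) x + jacT G x \<alpha> - jacT (\<lambda>x'. lagr f g (x', y, u)) x \<beta>
          - (\<Sum>i\<in>UNIV. \<Sum>j\<in>?J. mult i j *\<^sub>R nabla (\<lambda>x'. phi R \<theta> g t i j (x', y, u)) x) = 0" and
    ey: "nabla (\<lambda>y'. F (x, y')) y - jacT (\<lambda>y'. lagr f g (x, y', u)) y \<beta>
          - (\<Sum>i\<in>UNIV. \<Sum>j\<in>?J. mult i j *\<^sub>R nabla (\<lambda>y'. phi R \<theta> g t i j (x, y', u)) y) = 0" and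
    eu: "\<And>i. - (nabla (\<lambda>y'. g (x, y') $ i) y \<bullet> \<beta>)
          - (\<Sum>j\<in>?J. mult i j * nabla (\<lambda>u'. phi R \<theta> g t i j (x, y, u')) u $ i) = 0" and
    upper: "\<And>j. \<alpha> $ j \<ge> 0 \<and> G x $ j \<le> 0 \<and> \<alpha> $ j * G x $ j = 0" and
    kkt: "\<And>i j. j \<in> ?J \<Longrightarrow> mult i j \<ge> 0 \<and> phi R \<theta> g t i j (x, y, u) \<le> 0 \<and>
          mult i j * phi R \<theta> g t i j (x, y, u) = 0"
    using stat unfolding relaxed_stationary_def by blast
  define p q where "p i j = fst ((phi_grad_list R \<theta> t ! j) (g (x, y) $ i) (u $ i))"
    and "q i j = snd ((phi_grad_list R \<theta> t ! j) (g (x, y) $ i) (u $ i))" for i j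
  define \<gamma> where "\<gamma> = (\<chi> i. - (\<Sum>j\<in>?J. mult i j * p i j))"
  have px: "nabla (\<lambda>x'. phi R \<theta> g t i j (x', y, u)) x = p i j *\<^sub>R nabla (\<lambda>x'. g (x', y) $ i) x"
    and py: "nabla (\<lambda>y'. phi R \<theta> g t i j (x, y', u)) y = p i j *\<^sub>R nabla (\<lambda>y'. g (x, y') $ i) y"
    and pu: "nabla (\<lambda>u'. phi R \<theta> g t i j (x, y, u')) u $ i = q i j"
    if "j \<in> ?J" for i j
  proof -
    have "GDERIV (\<lambda>x'. g (x', y) $ i) x :> nabla (\<lambda>x'. g (x', y) $ i) x"
      unfolding nabla_fst[OF g] by (rule gderiv_section_fst[OF has_cont_gradD[OF g]])
    moreover have "GDERIV (\<lambda>y'. g (x, y') $ i) y :> nabla (\<lambda>y'. g (x, y') $ i) y"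
      unfolding nabla_snd[OF g] by (rule gderiv_section_snd[OF has_cont_gradD[OF g]])
    ultimately show "nabla (\<lambda>x'. phi R \<theta> g t i j (x', y, u)) x = p i j *\<^sub>R nabla (\<lambda>x'. g (x', y) $ i) x"
      "nabla (\<lambda>y'. phi R \<theta> g t i j (x, y', u)) y = p i j *\<^sub>R nabla (\<lambda>y'. g (x, y') $ i) y"
      "nabla (\<lambda>u'. phi R \<theta> g t i j (x, y, u')) u $ i = q i j"
      using that nabla_phi_constraint[OF reg t] nabla_phi_multiplier[OF reg t]
      by (simp_all add: phi_eq p_def q_def)
  qed
  have sx: "(\<Sum>i\<in>UNIV. \<Sum>j\<in>?J. mult i j *\<^sub>R nabla (\<lambda>x'. phi R \<theta> g t i j (x', y, u)) x)
      = - jacT (\<lambda>x'. g (x', y)) x \<gamma>"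
    by (simp add: px jacT_def \<gamma>_def scaleR_sum_left sum_negf)
  have sy: "(\<Sum>i\<in>UNIV. \<Sum>j\<in>?J. mult i j *\<^sub>R nabla (\<lambda>y'. phi R \<theta> g t i j (x, y', u)) y)
      = - jacT (\<lambda>y'. g (x, y')) y \<gamma>"
    by (simp add: py jacT_def \<gamma>_def scaleR_sum_left sum_negf)
  have a: "nabla (\<lambda>y'. g (x, y') $ i) y \<bullet> (- \<beta>) = (\<Sum>j\<in>?J. mult i j * q i j)" for i
    using eu[of i] by (simp add: pu)
  have signs: "\<bar>(nabla (\<lambda>y'. g (x, y') $ i) y \<bullet> (- \<beta>)) * u $ i + \<gamma> $ i * g (x, y) $ i\<bar>
        \<le> t * (\<bar>nabla (\<lambda>y'. g (x, y') $ i) y \<bullet> (- \<beta>)\<bar> + \<bar>\<gamma> $ i\<bar>)"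
    "c_sign (\<gamma> $ i) (nabla (\<lambda>y'. g (x, y') $ i) y \<bullet> (- \<beta>))"
    "R \<in> {Kadrani_Dussault_Benchakroun, Kanzow_Schwartz} \<Longrightarrow>
       m_sign (\<gamma> $ i) (nabla (\<lambda>y'. g (x, y') $ i) y \<bullet> (- \<beta>))" for i
    using relaxation_multiplier_signs[OF reg t, of R "mult i" "g (x, y) $ i" "u $ i"] kkt[of _ i]
    unfolding a \<gamma>_def vec_lambda_beta p_def q_def phi_eq by blast+
  show ?thesis
  proof (rule that)
    show "(y, u) \<in> S_relaxed R \<theta> F f g t x"
      using sol by (simp add: gph_def)
    show "nabla (\<lambda>x'. F (x', y)) x + jacT G x \<alpha>
       + (jacT (\<lambda>x'. lagr f g (x', y, u)) x (- \<beta>) + jacT (\<lambda>x'. g (x', y)) x \<gamma>) = 0"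
      using ex unfolding sx by (simp add: jacT_uminus algebra_simps)
    show "nabla (\<lambda>y'. F (x, y')) y
       + (jacT (\<lambda>y'. lagr f g (x, y', u)) y (- \<beta>) + jacT (\<lambda>y'. g (x, y')) y \<gamma>) = 0"
      using ey unfolding sy by (simp add: jacT_uminus algebra_simps)
    show "\<alpha> \<ge> 0" "G x \<le> 0"
      using upper by (simp_all add: less_eq_vec_def)
    show "\<alpha> \<bullet> G x = 0"
      unfolding inner_vec_def inner_real_def using upper by (intro sum.neutral) blast
    show "relaxed_signs c_sign g t (x, y, u) (- \<beta>) \<gamma>"
      using signs(1,2) unfolding relaxed_signs_def Let_def case_prod_conv by blast
    show "relaxed_signs m_sign g t (x, y, u) (- \<beta>) \<gamma>"
      if "R \<in> {Kadrani_Dussault_Benchakroun, Kanzow_Schwartz}"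
      using signs(1,3) that unfolding relaxed_signs_def Let_def case_prod_conv by blast
  qed
qed

text \<open>The signs \<open>\<sigma>\<close> of the conclusion come from the relaxation, while the type \<open>\<tau>\<close> of the
qualification conditions is arbitrary, as \<open>homogeneous_multipliers_vanish\<close> needs only C-type signs.
The pair \<open>(\<beta>, \<gamma>)\<close> is bounded before \<open>\<alpha>\<close>: the equation in \<open>y\<close> does not contain \<open>\<alpha>\<close>.\<close>

lemma stationarity_in_the_limit:
  fixes F f :: "(real ^ 'n) \<times> (real ^ 'm) \<Rightarrow> real"
    and G :: "real ^ 'n \<Rightarrow> real ^ 'p"
    and g :: "(real ^ 'n) \<times> (real ^ 'm) \<Rightarrow> real ^ 'q"
  assumes F: "cont_diff 2 F" and G: "cont_diff 2 G" and f: "cont_diff 2 f" and g: "cont_diff 2 g"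
    and conv: "\<And>z. G z \<le> 0 \<Longrightarrow> convex_on UNIV (\<lambda>y. f (z, y))"
      "\<And>z i. G z \<le> 0 \<Longrightarrow> convex_on UNIV (\<lambda>y. g (z, y) $ i)"
    and T: "T \<longlonglongrightarrow> 0" and X: "X \<longlonglongrightarrow> x" and Y: "Y \<longlonglongrightarrow> y" and U: "U \<longlonglongrightarrow> u"
    and sol: "(y, u) \<in> S_p F f g x"
    and ex: "\<And>k. nabla (\<lambda>x'. F (x', Y k)) (X k) + jacT G (X k) (A k)
       + (jacT (\<lambda>x'. lagr f g (x', Y k, U k)) (X k) (B k) + jacT (\<lambda>x'. g (x', Y k)) (X k) (\<Gamma> k)) = 0"
    and ey: "\<And>k. nabla (\<lambda>y'. F (X k, y')) (Y k)
       + (jacT (\<lambda>y'. lagr f g (X k, y', U k)) (Y k) (B k) + jacT (\<lambda>y'. g (X k, y')) (Y k) (\<Gamma> k)) = 0"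
    and upper: "\<And>k. A k \<ge> 0" "\<And>k. G (X k) \<le> 0" "\<And>k. A k \<bullet> G (X k) = 0"
    and c_signs: "\<And>k. relaxed_signs c_sign g (T k) (X k, Y k, U k) (B k) (\<Gamma> k)"
    and \<sigma>: "\<sigma> \<in> {c_sign, m_sign}"
    and signs: "\<And>k. relaxed_signs \<sigma> g (T k) (X k, Y k, U k) (B k) (\<Gamma> k)"
    and regular: "upper_level_regular G x"
    and \<tau>: "\<tau> \<in> {c_sign, m_sign}"
    and A1: "cond_A1 \<tau> f g (x, y, u)" and A2: "cond_A2 \<tau> f g (x, y, u)"
  shows "bilevel_stationary \<sigma> F G f g x"
proof -
  have FC: "has_cont_grad F"
    using F by (rule cont_diff_imp_has_cont_grad) simp
  have GC: "has_cont_grad (\<lambda>z. G z $ j)" and gC: "has_cont_grad (\<lambda>p. g p $ i)" for i j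
    using has_cont_grad_component[OF G] has_cont_grad_component[OF g] by auto
  note LC = lagr_has_cont_grad[OF f g]
  have c\<sigma>: "c_sign \<in> {c_sign, m_sign}"
    by simp
  \<comment> \<open>The parts of the two equations that are linear in \<open>(\<beta>, \<gamma>)\<close>.\<close>
  define Wx Wy where
    "Wx x y u \<beta> \<gamma> = jacT (\<lambda>x'. lagr f g (x', y, u)) x \<beta> + jacT (\<lambda>x'. g (x', y)) x \<gamma>"
    and "Wy x y u \<beta> \<gamma> = jacT (\<lambda>y'. lagr f g (x, y', u)) y \<beta> + jacT (\<lambda>y'. g (x, y')) y \<gamma>"
    for x y u \<beta> \<gamma>
  have W_scale: "Wx x y u (c *\<^sub>R \<beta>) (c *\<^sub>R \<gamma>) = c *\<^sub>R Wx x y u \<beta> \<gamma>"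
    "Wy x y u (c *\<^sub>R \<beta>) (c *\<^sub>R \<gamma>) = c *\<^sub>R Wy x y u \<beta> \<gamma>" for x y u \<beta> \<gamma> c
    by (simp_all add: Wx_def Wy_def jacT_scaleR scaleR_add_right)
  have W_lim: "(\<lambda>k. Wx (X (r k)) (Y (r k)) (U (r k)) (B' k) (\<Gamma>' k)) \<longlonglongrightarrow> Wx x y u \<beta> \<gamma>"
    "(\<lambda>k. Wy (X (r k)) (Y (r k)) (U (r k)) (B' k) (\<Gamma>' k)) \<longlonglongrightarrow> Wy x y u \<beta> \<gamma>"
    if r: "filterlim r sequentially sequentially" and B': "B' \<longlonglongrightarrow> \<beta>" and \<Gamma>': "\<Gamma>' \<longlonglongrightarrow> \<gamma>" for r B' \<Gamma>' \<beta> \<gamma>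
  proof -
    note lims = filterlim_compose[OF X r] filterlim_compose[OF Y r] filterlim_compose[OF U r]
    show "(\<lambda>k. Wx (X (r k)) (Y (r k)) (U (r k)) (B' k) (\<Gamma>' k)) \<longlonglongrightarrow> Wx x y u \<beta> \<gamma>"
      unfolding Wx_def
      by (intro tendsto_add jacT_fst_tendsto[OF LC _ tendsto_Pair] jacT_fst_tendsto[OF gC] lims B' \<Gamma>')
    show "(\<lambda>k. Wy (X (r k)) (Y (r k)) (U (r k)) (B' k) (\<Gamma>' k)) \<longlonglongrightarrow> Wy x y u \<beta> \<gamma>"
      unfolding Wy_def
      by (intro tendsto_add jacT_mid_tendsto[OF LC] jacT_snd_tendsto[OF gC] lims B' \<Gamma>')
  qed
  have Fx_lim: "(\<lambda>k. nabla (\<lambda>x'. F (x', Y (r k))) (X (r k))) \<longlonglongrightarrow> nabla (\<lambda>x'. F (x', y)) x"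
    and Fy_lim: "(\<lambda>k. nabla (\<lambda>y'. F (X (r k), y')) (Y (r k))) \<longlonglongrightarrow> nabla (\<lambda>y'. F (x, y')) y"
    if r: "filterlim r sequentially sequentially" for r
    unfolding nabla_fst[OF FC] nabla_snd[OF FC]
    by (intro tendsto_intros has_cont_grad_tendsto[OF FC] filterlim_compose[OF X r] filterlim_compose[OF Y r])+
  have G_lim: "(\<lambda>k. G (X (r k)) $ j) \<longlonglongrightarrow> G x $ j" if r: "filterlim r sequentially sequentially" for r j
    using continuous_on_tendsto_compose[OF has_cont_grad_cont[OF GC] filterlim_compose[OF X r]] by simp
  have jG_lim: "(\<lambda>k. jacT G (X (r k)) (A' k)) \<longlonglongrightarrow> jacT G x \<alpha>"
    if r: "filterlim r sequentially sequentially" and "A' \<longlonglongrightarrow> \<alpha>" for r A' \<alpha>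
    unfolding jacT_def by (intro tendsto_intros has_cont_grad_tendsto[OF GC] filterlim_compose[OF X r] that)
  have feasible: "G x \<le> 0"
    unfolding less_eq_vec_def
  proof
    fix j
    have "(\<lambda>k. G (X k) $ j) \<longlonglongrightarrow> G x $ j"
      using G_lim[OF filterlim_ident] .
    then show "G x $ j \<le> 0 $ j"
      using upper(2) by (intro tendsto_upperbound[of _ "G x $ j"]) (auto simp: less_eq_vec_def)
  qed
  have compl: "\<alpha> \<ge> 0" "\<alpha> \<bullet> G x = 0"
    if r: "filterlim r sequentially sequentially" and A': "A' \<longlonglongrightarrow> \<alpha>"
      and "\<And>k. A' k \<ge> 0" "\<And>k. A' k \<bullet> G (X (r k)) = 0" for r A' \<alpha>
  proof -
    show "\<alpha> \<ge> 0"
      unfolding less_eq_vec_def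
    proof
      fix j
      show "0 $ j \<le> \<alpha> $ j"
        using tendsto_vec_nth[OF A', of j] that(3)
        by (intro tendsto_lowerbound[of "\<lambda>k. A' k $ j" "\<alpha> $ j"]) (auto simp: less_eq_vec_def)
    qed
    have "(\<lambda>k. A' k \<bullet> G (X (r k))) \<longlonglongrightarrow> \<alpha> \<bullet> G x"
      unfolding inner_vec_def inner_real_def by (intro tendsto_intros A' G_lim[OF r])
    then show "\<alpha> \<bullet> G x = 0"
      using that(4) by (simp add: LIMSEQ_const_iff)
  qed
  have kkt: "(y, u) \<in> kkt_set f g x"
    using sol by (auto simp: max_solutions_def)
  obtain r \<beta> \<gamma> where r: "filterlim r sequentially sequentially"
    and BG: "(\<lambda>k. B (r k)) \<longlonglongrightarrow> \<beta>" "(\<lambda>k. \<Gamma> (r k)) \<longlonglongrightarrow> \<gamma>"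
  proof (cases "\<lambda>k. (B k, \<Gamma> k)" rule: convergent_or_unbounded_direction)
    case (convergent r l)
    then show ?thesis
      using that[of r "fst l" "snd l"] tendsto_fst[OF convergent(2)] tendsto_snd[OF convergent(2)] by simp
  next
    case (unbounded r c d)
    obtain \<beta> \<gamma> where d: "d = (\<beta>, \<gamma>)"
      by (cases d)
    have lims: "(\<lambda>k. c k *\<^sub>R B (r k)) \<longlonglongrightarrow> \<beta>" "(\<lambda>k. c k *\<^sub>R \<Gamma> (r k)) \<longlonglongrightarrow> \<gamma>"
      using tendsto_fst[OF unbounded(4)] tendsto_snd[OF unbounded(4)] by (simp_all add: d)
    have "sign_system c_sign g (x, y, u) \<beta> \<gamma>"
      using c\<sigma> gC filterlim_compose[OF T unbounded(1)] filterlim_compose[OF X unbounded(1)]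
        filterlim_compose[OF Y unbounded(1)] filterlim_compose[OF U unbounded(1)] lims
        relaxed_signs_scale[OF c\<sigma> c_signs unbounded(2)]
      by (rule relaxed_signs_tendsto)
    moreover have "Wy x y u \<beta> \<gamma> = 0"
    proof (rule LIMSEQ_unique)
      show "(\<lambda>k. Wy (X (r k)) (Y (r k)) (U (r k)) (c k *\<^sub>R B (r k)) (c k *\<^sub>R \<Gamma> (r k))) \<longlonglongrightarrow> Wy x y u \<beta> \<gamma>"
        using unbounded(1) lims by (rule W_lim)
      have "(\<lambda>k. - (c k *\<^sub>R nabla (\<lambda>y'. F (X (r k), y')) (Y (r k)))) \<longlonglongrightarrow> - (0 *\<^sub>R nabla (\<lambda>y'. F (x, y')) y)"
        by (intro tendsto_intros unbounded(3) Fy_lim[OF unbounded(1)])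
      moreover have "Wy (X k) (Y k) (U k) (B k) (\<Gamma> k) = - nabla (\<lambda>y'. F (X k, y')) (Y k)" for k
        using ey[of k] by (simp add: Wy_def add_eq_0_iff)
      ultimately show "(\<lambda>k. Wy (X (r k)) (Y (r k)) (U (r k)) (c k *\<^sub>R B (r k)) (c k *\<^sub>R \<Gamma> (r k))) \<longlonglongrightarrow> 0"
        by (simp add: W_scale)
    qed
    ultimately have "\<beta> = 0" "\<gamma> = 0"
      using homogeneous_multipliers_vanish[OF f g conv[OF feasible] kkt _ _ \<tau> A1 A2, of \<beta> \<gamma>]
      unfolding Wy_def by blast+
    then show ?thesis
      using unbounded(5) d by simp
  qed
  obtain s \<alpha> where s: "filterlim s sequentially sequentially" and A: "(\<lambda>k. A (r (s k))) \<longlonglongrightarrow> \<alpha>"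
  proof (cases "\<lambda>k. A (r k)" rule: convergent_or_unbounded_direction)
    case (unbounded s c \<alpha>)
    have rs: "filterlim (\<lambda>k. r (s k)) sequentially sequentially"
      using r unbounded(1) by (rule filterlim_compose)
    have "c k *\<^sub>R A (r (s k)) \<ge> 0" for k
      using upper(1)[of "r (s k)"] unbounded(2)[of k] by (simp add: less_eq_vec_def)
    then have "\<alpha> \<ge> 0" "\<alpha> \<bullet> G x = 0"
      using compl[OF rs unbounded(4)] upper(3) by simp_all
    moreover have "jacT G x \<alpha> = 0"
    proof (rule LIMSEQ_unique)
      show "(\<lambda>k. jacT G (X (r (s k))) (c k *\<^sub>R A (r (s k)))) \<longlonglongrightarrow> jacT G x \<alpha>"
        using rs unbounded(4) by (rule jG_lim)
      have "(\<lambda>k. - (c k *\<^sub>R (nabla (\<lambda>x'. F (x', Y (r (s k)))) (X (r (s k)))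
          + Wx (X (r (s k))) (Y (r (s k))) (U (r (s k))) (B (r (s k))) (\<Gamma> (r (s k))))))
          \<longlonglongrightarrow> - (0 *\<^sub>R (nabla (\<lambda>x'. F (x', y)) x + Wx x y u \<beta> \<gamma>))"
        by (intro tendsto_intros unbounded(3) Fx_lim[OF rs] W_lim(1)[OF rs]
            filterlim_compose[OF BG(1) unbounded(1)] filterlim_compose[OF BG(2) unbounded(1)])
      moreover have "jacT G (X k) (A k) = - (nabla (\<lambda>x'. F (x', Y k)) (X k) + Wx (X k) (Y k) (U k) (B k) (\<Gamma> k))" for k
        using ex[of k] by (simp add: Wx_def eq_neg_iff_add_eq_0 algebra_simps)
      ultimately show "(\<lambda>k. jacT G (X (r (s k))) (c k *\<^sub>R A (r (s k)))) \<longlonglongrightarrow> 0"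
        by (simp only: jacT_scaleR scaleR_minus_right scaleR_zero_left minus_zero)
    qed
    ultimately have "\<alpha> = 0"
      using regular unfolding upper_level_regular_def by blast
    then show ?thesis
      using unbounded(5) by simp
  qed (rule that)
  have rs: "filterlim (\<lambda>k. r (s k)) sequentially sequentially"
    using r s by (rule filterlim_compose)
  note BG' = filterlim_compose[OF BG(1) s] filterlim_compose[OF BG(2) s]
  have "sign_system \<sigma> g (x, y, u) \<beta> \<gamma>"
    using \<sigma> gC filterlim_compose[OF T rs] filterlim_compose[OF X rs]
      filterlim_compose[OF Y rs] filterlim_compose[OF U rs] BG' signs
    by (rule relaxed_signs_tendsto)
  moreover have "nabla (\<lambda>x'. F (x', y)) x + jacT G x \<alpha> + Wx x y u \<beta> \<gamma> = 0"
    using tendsto_add[OF tendsto_add[OF Fx_lim[OF rs] jG_lim[OF rs A]] W_lim(1)[OF rs BG']] ex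
    by (simp add: Wx_def LIMSEQ_const_iff)
  moreover have "nabla (\<lambda>y'. F (x, y')) y + Wy x y u \<beta> \<gamma> = 0"
    using tendsto_add[OF Fy_lim[OF rs] W_lim(2)[OF rs BG']] ey
    by (simp add: Wy_def LIMSEQ_const_iff)
  moreover have "\<alpha> \<ge> 0" "\<alpha> \<bullet> G x = 0"
    using compl[OF rs A] upper(1,3) by simp_all
  ultimately show ?thesis
    using sol feasible unfolding bilevel_stationary_def Wx_def Wy_def
    by (intro exI[of _ y] exI[of _ u] exI[of _ \<alpha>] exI[of _ \<beta>] exI[of _ \<gamma>])
      (simp add: gph_def add.assoc)
qed

theorem theorem4p4:
  fixes F f :: "(real ^ 'n) \<times> (real ^ 'm) \<Rightarrow> real"
    and G :: "real ^ 'n \<Rightarrow> real ^ 'p"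
    and g :: "(real ^ 'n) \<times> (real ^ 'm) \<Rightarrow> real ^ 'q"
    and \<theta> :: "real \<Rightarrow> real"
    and R :: relaxation
    and t :: "nat \<Rightarrow> real"
    and x :: "nat \<Rightarrow> real ^ 'n"
    and xbar :: "real ^ 'n"
  assumes smooth: "cont_diff 2 F" "cont_diff 2 G" "cont_diff 3 f" "cont_diff 3 g"
    and lower_solvable: "\<And>z. G z \<le> 0 \<Longrightarrow> lower_solutions f g z \<noteq> {}"
    and lower_convex: "\<And>z. G z \<le> 0 \<Longrightarrow> convex_on UNIV (\<lambda>y. f (z, y))"
      "\<And>z i. G z \<le> 0 \<Longrightarrow> convex_on UNIV (\<lambda>y. g (z, y) $ i)"
    and slater: "\<And>z. G z \<le> 0 \<Longrightarrow> \<exists>y. \<forall>i. g (z, y) $ i < 0"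
    and regfun: "regularization_function \<theta>"
    and relaxed_nonempty: "\<And>R' s z. s > 0 \<Longrightarrow> relaxed_set R' \<theta> f g s z \<noteq> {}"
    and t_pos: "\<And>k. t k > 0"
    and t_decreasing: "decseq t"
    and t_lim: "t \<longlonglongrightarrow> 0"
    and x_lim: "x \<longlonglongrightarrow> xbar"
    and x_stationary: "\<And>k. relaxed_stationary R \<theta> F G f g (t k) (x k)"
    and excess_lim: "(\<lambda>k. excess (S_relaxed R \<theta> F f g (t k) (x k)) (S_p F f g xbar)) \<longlonglongrightarrow> 0"
    and upper_regular: "upper_level_regular G xbar"
    and S_p_nonempty: "S_p F f g xbar \<noteq> {}"
    and S_p_compact: "compact (S_p F f g xbar)"
  shows
    "(R \<in> {Scholtes, Lin_Fukushima, Steffensen_Ulbrich} \<and>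
      (\<forall>y u. (xbar, y, u) \<in> gph (S_p F f g) \<longrightarrow>
         cond_A1 m_sign f g (xbar, y, u) \<and> cond_A2 m_sign f g (xbar, y, u))
      \<longrightarrow> C_stationary F G f g xbar) \<and>
     (R \<in> {Kadrani_Dussault_Benchakroun, Kanzow_Schwartz} \<and>
      (\<forall>y u. (xbar, y, u) \<in> gph (S_p F f g) \<longrightarrow>
         cond_A1 c_sign f g (xbar, y, u) \<and> cond_A2 c_sign f g (xbar, y, u))
      \<longrightarrow> M_stationary F G f g xbar)"
proof -
  have C2: "cont_diff 2 f" "cont_diff 2 g"
    using smooth(3,4) cont_diff_SucD[of 2 f] cont_diff_SucD[of 2 g] by (simp_all del: cont_diff.simps)
  have gC: "has_cont_grad (\<lambda>p. g p $ i)" for i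
    using smooth(4) by (rule has_cont_grad_component) simp
  have "\<exists>w \<alpha> \<beta> \<gamma>. w \<in> S_relaxed R \<theta> F f g (t k) (x k) \<and>
      nabla (\<lambda>x'. F (x', fst w)) (x k) + jacT G (x k) \<alpha>
        + (jacT (\<lambda>x'. lagr f g (x', fst w, snd w)) (x k) \<beta> + jacT (\<lambda>x'. g (x', fst w)) (x k) \<gamma>) = 0 \<and>
      nabla (\<lambda>y'. F (x k, y')) (fst w)
        + (jacT (\<lambda>y'. lagr f g (x k, y', snd w)) (fst w) \<beta> + jacT (\<lambda>y'. g (x k, y')) (fst w) \<gamma>) = 0 \<and>
      \<alpha> \<ge> 0 \<and> G (x k) \<le> 0 \<and> \<alpha> \<bullet> G (x k) = 0 \<and>
      relaxed_signs c_sign g (t k) (x k, fst w, snd w) \<beta> \<gamma> \<and>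
      (R \<in> {Kadrani_Dussault_Benchakroun, Kanzow_Schwartz} \<longrightarrow>
        relaxed_signs m_sign g (t k) (x k, fst w, snd w) \<beta> \<gamma>)" for k
  proof (rule relaxed_stationaryE[OF regfun t_pos gC x_stationary[of k]])
    fix y u \<alpha> \<beta> \<gamma>
    assume *: "(y, u) \<in> S_relaxed R \<theta> F f g (t k) (x k)"
      "nabla (\<lambda>x'. F (x', y)) (x k) + jacT G (x k) \<alpha>
         + (jacT (\<lambda>x'. lagr f g (x', y, u)) (x k) \<beta> + jacT (\<lambda>x'. g (x', y)) (x k) \<gamma>) = 0"
      "nabla (\<lambda>y'. F (x k, y')) y
         + (jacT (\<lambda>y'. lagr f g (x k, y', u)) y \<beta> + jacT (\<lambda>y'. g (x k, y')) y \<gamma>) = 0"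
      "\<alpha> \<ge> 0" "G (x k) \<le> 0" "\<alpha> \<bullet> G (x k) = 0"
      "relaxed_signs c_sign g (t k) (x k, y, u) \<beta> \<gamma>"
      "R \<in> {Kadrani_Dussault_Benchakroun, Kanzow_Schwartz} \<Longrightarrow>
         relaxed_signs m_sign g (t k) (x k, y, u) \<beta> \<gamma>"
    show ?thesis
      by (intro exI[of _ "(y, u)"] exI[of _ \<alpha>] exI[of _ \<beta>] exI[of _ \<gamma>] conjI impI)
        (simp_all only: fst_conv snd_conv *)
  qed
  then obtain w \<alpha> \<beta> \<gamma> where
    w: "\<And>k. w k \<in> S_relaxed R \<theta> F f g (t k) (x k)" and
    ex: "\<And>k. nabla (\<lambda>x'. F (x', fst (w k))) (x k) + jacT G (x k) (\<alpha> k)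
        + (jacT (\<lambda>x'. lagr f g (x', fst (w k), snd (w k))) (x k) (\<beta> k)
          + jacT (\<lambda>x'. g (x', fst (w k))) (x k) (\<gamma> k)) = 0" and
    ey: "\<And>k. nabla (\<lambda>y'. F (x k, y')) (fst (w k))
        + (jacT (\<lambda>y'. lagr f g (x k, y', snd (w k))) (fst (w k)) (\<beta> k)
          + jacT (\<lambda>y'. g (x k, y')) (fst (w k)) (\<gamma> k)) = 0" and
    upper: "\<And>k. \<alpha> k \<ge> 0" "\<And>k. G (x k) \<le> 0" "\<And>k. \<alpha> k \<bullet> G (x k) = 0" and
    c: "\<And>k. relaxed_signs c_sign g (t k) (x k, fst (w k), snd (w k)) (\<beta> k) (\<gamma> k)" and
    m: "\<And>k. R \<in> {Kadrani_Dussault_Benchakroun, Kanzow_Schwartz} \<Longrightarrow>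
        relaxed_signs m_sign g (t k) (x k, fst (w k), snd (w k)) (\<beta> k) (\<gamma> k)"
    by metis
  obtain r wbar where r: "filterlim r sequentially sequentially"
    and wbar: "wbar \<in> S_p F f g xbar" and w_lim: "(\<lambda>k. w (r k)) \<longlonglongrightarrow> wbar"
    using S_p_compact S_p_nonempty w excess_lim by (rule convergent_subsequence_of_excess_zero)
  obtain y u where yu: "wbar = (y, u)"
    by (cases wbar)
  have sol: "(y, u) \<in> S_p F f g xbar"
    using wbar by (simp add: yu)
  have Y: "(\<lambda>k. fst (w (r k))) \<longlonglongrightarrow> y" and U: "(\<lambda>k. snd (w (r k))) \<longlonglongrightarrow> u"
    using tendsto_fst[OF w_lim] tendsto_snd[OF w_lim] by (simp_all add: yu)
  note limit = stationarity_in_the_limit[OF smooth(1,2) C2 lower_convex filterlim_compose[OF t_lim r]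
      filterlim_compose[OF x_lim r] Y U sol ex ey upper c _ _ upper_regular]
  have "C_stationary F G f g xbar"
    if "cond_A1 m_sign f g (xbar, y, u)" "cond_A2 m_sign f g (xbar, y, u)"
    using that by (intro limit[of c_sign m_sign] c) simp_all
  moreover have "M_stationary F G f g xbar"
    if "R \<in> {Kadrani_Dussault_Benchakroun, Kanzow_Schwartz}"
      "cond_A1 c_sign f g (xbar, y, u)" "cond_A2 c_sign f g (xbar, y, u)"
    using that(2,3) by (intro limit[of m_sign c_sign] m[OF that(1)]) simp_all
  ultimately show ?thesis
    using sol unfolding gph_def by blast
qed

end
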